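(* Let $n\ge 2$ and $m\ge 1$ be integers. Let $\alpha=(\alpha_1,\ldots,\alpha_m)\in\mathbb{R}^m$ and let $s_0(\alpha),\ldots,s_m(\alpha)$ be the coefficients defined by $\prod_{i=1}^m(\alpha_i+t)=\sum_{k=0}^m s_k(\alpha)\,t^k$. Assume that $s_0(\alpha),\ldots,s_{m-1}(\alpha)\in[0,+\infty)$. Let $\Omega\subseteq\mathbb{R}^n$ be an open, bounded and connected set with $0\in\Omega$ which is convex in the $x_1$-direction and symmetric with respect to the hyperplane $\{x_1=0\}$. Let $f:[0,+\infty)\to\mathbb{R}$ be (globally) Lipschitz continuous and non-decreasing, with $f(0)\ge 0$. Let $u\in C^{2m}(\Omega\setminus\{0\})\cap C^{2m-2}(\overline{\Omega}\setminus\{0\})$ be a real-valued classical solution of the boundary value problem $$\begin{cases}\sum_{k=0}^m s_k(\alpha)(-\Delta)^k u=f(u) & \text{in }\Omega\setminus\{0\},\\ u>0 & \text{in }\Omega\setminus\{0\},\\ u=-\Delta u=\cdots=(-\Delta)^{m-1}u=0 & \text{on }\partial\Omega,\\ \inf_{\Omega\setminus\{0\}}(-\Delta)^j u>-\infty & \text{for } j=1,\ldots,m-1.\end{cases}$$ Then: (1) $u$ is symmetric in $x_1$, i.e. $u(x_1,x_2,\ldots,x_n)=u(-x_1,x_2,\ldots,x_n)$ for every $x=(x_1,\ldots,x_n)\in\Omega\setminus\{0\}$; (2) $u$ is decreasing with respect to $x_1$ on $\Omega\cap\{x_1>0\}$.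
   Context: $\Omega$ is convex in the $x_1$-direction if, whenever $p=(p_1,\dots,p_n)$ and $q=(q_1,\dots,q_n)$ belong to $\Omega$ and $p_j=q_j$ for all $j\in\{2,\dots,n\}$, the point $(1-t)p+tq$ belongs to $\Omega$ for all $t\in[0,1]$. $\Omega$ is symmetric with respect to $\{x_1=0\}$ if $(p_1,p_2,\dots,p_n)\in\Omega$ implies $(-p_1,p_2,\dots,p_n)\in\Omega$. No regularity of $\partial\Omega$ is assumed. The coefficients are explicitly $s_m(\alpha)=1$ and $s_k(\alpha)=\sum_{1\le i_1<\cdots<i_{m-k}\le m}\alpha_{i_1}\cdots\alpha_{i_{m-k}}$ for $k=0,\ldots,m-1$. Here $(-\Delta)^0u=u$. When $m=1$ the last condition in the boundary value problem is void. *)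

theory Defs
  imports "HOL-Analysis.Analysis" "HOL-Computational_Algebra.Polynomial"
begin

definition reflect :: "'n::finite \<Rightarrow> real ^ 'n \<Rightarrow> real ^ 'n" where
  "reflect i x = (\<chi> j. if j = i then - x $ j else x $ j)"

definition symmetric_in :: "'n::finite \<Rightarrow> (real ^ 'n) set \<Rightarrow> bool" where
  "symmetric_in i S \<longleftrightarrow> (\<forall>p\<in>S. reflect i p \<in> S)"

definition convex_in_direction :: "'n::finite \<Rightarrow> (real ^ 'n) set \<Rightarrow> bool" where
  "convex_in_direction i S \<longleftrightarrow>
     (\<forall>p\<in>S. \<forall>q\<in>S. (\<forall>j. j \<noteq> i \<longrightarrow> p $ j = q $ j) \<longrightarrow>
        (\<forall>t\<in>{0..1}. (1 - t) *\<^sub>R p + t *\<^sub>R q \<in> S))"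

definition s_coeff :: "nat \<Rightarrow> (nat \<Rightarrow> real) \<Rightarrow> nat \<Rightarrow> real" where
  "s_coeff m \<alpha> k = coeff (\<Prod>i=1..m. [:\<alpha> i, 1:]) k"

definition partial_deriv :: "'n::finite \<Rightarrow> (real ^ 'n \<Rightarrow> real) \<Rightarrow> real ^ 'n \<Rightarrow> real" where
  "partial_deriv i f x = deriv (\<lambda>t. f (x + t *\<^sub>R axis i 1)) 0"

(* The head of the list is the variable differentiated last. *)
definition iter_partial :: "'n::finite list \<Rightarrow> (real ^ 'n \<Rightarrow> real) \<Rightarrow> real ^ 'n \<Rightarrow> real" where
  "iter_partial is f = foldr partial_deriv is f"

(* The space C^k(U) for open U: all partial derivatives up to order k exist and are continuous. *)
definition Ck_on :: "nat \<Rightarrow> (real ^ 'n::finite) set \<Rightarrow> (real ^ 'n \<Rightarrow> real) \<Rightarrow> bool" where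
  "Ck_on k U f \<longleftrightarrow>
     (\<forall>is. length is < k \<longrightarrow>
        (\<forall>i. \<forall>x\<in>U. (\<lambda>t. iter_partial is f (x + t *\<^sub>R axis i 1)) field_differentiable at 0)) \<and>
     (\<forall>is. length is \<le> k \<longrightarrow> continuous_on U (iter_partial is f))"

(* C^k up to the part of the boundary of the open set U that lies in K (U \<subseteq> K \<subseteq> closure U):
   f is C^k on U and all its partial derivatives up to order k extend continuously to K.
   Only the values of f on U matter. *)
definition Ck_up_to :: "nat \<Rightarrow> (real ^ 'n::finite) set \<Rightarrow> (real ^ 'n) set \<Rightarrow> (real ^ 'n \<Rightarrow> real) \<Rightarrow> bool" where
  "Ck_up_to k U K f \<longleftrightarrow>
     Ck_on k U f \<and>
     (\<forall>is. length is \<le> k \<longrightarrow>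
        (\<exists>g. continuous_on K g \<and> (\<forall>x\<in>U. g x = iter_partial is f x)))"

definition neg_laplacian :: "(real ^ 'n::finite \<Rightarrow> real) \<Rightarrow> real ^ 'n \<Rightarrow> real" where
  "neg_laplacian f x = - (\<Sum>i\<in>UNIV. partial_deriv i (partial_deriv i f) x)"

(* The continuous extension of f from the open set U to the boundary set B vanishes on B. *)
definition vanishes_on_boundary :: "(real ^ 'n::finite) set \<Rightarrow> (real ^ 'n) set \<Rightarrow> (real ^ 'n \<Rightarrow> real) \<Rightarrow> bool" where
  "vanishes_on_boundary U B f \<longleftrightarrow> (\<forall>x\<in>B. (f \<longlongrightarrow> 0) (at x within U))"

end

theory Submission
  imports Defs
begin

text \<open>
  The equation has order \<open>2m\<close>, but it factors. The polynomial \<open>\<Prod>(\<alpha>\<^sub>i + t)\<close> has nonnegative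
  coefficients, so its roots \<open>- \<alpha>\<^sub>i\<close> are nonpositive. Putting
  \<open>u\<^sub>j = (- \<Delta> + \<alpha>\<^sub>j) \<dots> (- \<Delta> + \<alpha>\<^sub>1) u\<close> turns the problem into the second-order system
  \<open>- \<Delta> u\<^sub>j + \<alpha>\<^sub>j\<^sub>+\<^sub>1 u\<^sub>j = u\<^sub>j\<^sub>+\<^sub>1\<close> for \<open>j < m - 1\<close>, closed by \<open>f(u\<^sub>0)\<close> in the last equation. Each \<open>u\<^sub>j\<close>
  vanishes on the boundary and is bounded below near \<open>0\<close>, and every coupling is nondecreasing in the
  next unknown. The method of moving planes applies to such a system: reflect at \<open>{x\<^sub>1 = l}\<close>, and show
  that the differences \<open>w\<^sub>j = u\<^sub>j \<circ> reflection - u\<^sub>j\<close> are nonnegative on the cap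
  \<open>{x \<in> \<Omega>. x\<^sub>1 > l}\<close> for every \<open>l > 0\<close>.

  The boundary of \<open>\<Omega>\<close> is arbitrary, so the maximum principles have to hold on general open
  sets. All of them come from one computation. Let \<open>q(z) = |z - x\<^sub>0|\<^sup>2\<close> and let \<open>F(r)\<close> be
  \<open>r\<^bsup>-n/2-2\<^esup> \<integral> v (r - q)\<^sub>+\<^sup>2\<close>, a weighted mean of \<open>v\<close> over the ball of radius \<open>\<surd>r\<close>. Integrating by parts
  twice gives \<open>F'(r) = r\<^bsup>-n/2-3\<^esup> / 12 \<integral> \<Delta>v (r - q)\<^sub>+\<^sup>3\<close> (\<open>bump_mean_deriv\<close>), while \<open>F(r) \<rightarrow> c v(x\<^sub>0)\<close> as
  \<open>r \<rightarrow> 0\<close>. Two consequences follow.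

  \<^item> If \<open>\<Delta>v \<le> a v\<close>, \<open>v \<ge> 0\<close> and \<open>v(x\<^sub>0) = 0\<close>, then Gronwall's inequality gives \<open>F = 0\<close>, hence \<open>v = 0\<close> near
    \<open>x\<^sub>0\<close>: the strong maximum principle (\<open>strong_maximum_principle\<close>).
  \<^item> If \<open>v \<ge> 0\<close> has compact support of small measure and \<open>\<Delta>v \<ge> - M\<close>, then \<open>v(x\<^sub>0)\<close> is small compared with
    \<open>sup v\<close> and \<open>M\<close>. Applied to a smooth truncation of the negative part of \<open>w\<^sub>j\<close>, this halves any lower
    bound of a system whose negative set has small measure, and iteration gives \<open>w\<^sub>j \<ge> 0\<close>
    (\<open>maximum_principle_system\<close>). The singular point is removed by adding a small multiple of the
    superharmonic function \<open>- log |x - a|\<close>.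

  The set of \<open>l > 0\<close> for which all \<open>w\<^sub>j\<close> are nonnegative contains all large \<open>l\<close>, because the cap is then
  empty. It is closed by continuity. It is open because, by the strong maximum principle, every
  nontrivial \<open>w\<^sub>j\<close> is positive on a compact part of the cap whose complement has small measure; nearby
  caps are then handled by the maximum principle for small sets (\<open>eventually_ordered\<close>). By
  connectedness the set is all of \<open>(0, \<infinity>)\<close>. Strict positivity of \<open>w\<^sub>0\<close> is the monotonicity of \<open>u\<close>, and
  letting \<open>l \<rightarrow> 0\<close> for \<open>u\<close> and for its mirror image gives the symmetry.
\<close>

section \<open>Functions with continuous pure second partial derivatives\<close>

text \<open>
  The derivatives are explicit parameters, so that sums, compositions and reflections can be
  differentiated by formula. Pure second partials suffice to describe the problem, because the
  Laplacian and every integration by parts below work along one coordinate axis at a time.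
\<close>

definition twice_diff_on ::
    "(real ^ 'n::finite) set \<Rightarrow> (real ^ 'n \<Rightarrow> real) \<Rightarrow> ('n \<Rightarrow> real ^ 'n \<Rightarrow> real) \<Rightarrow>
      ('n \<Rightarrow> real ^ 'n \<Rightarrow> real) \<Rightarrow> bool" where
  "twice_diff_on U v v1 v2 \<longleftrightarrow>
     continuous_on U v \<and>
     (\<forall>i. continuous_on U (v1 i) \<and> continuous_on U (v2 i) \<and>
        (\<forall>x\<in>U. ((\<lambda>t. v (x + t *\<^sub>R axis i 1)) has_real_derivative v1 i x) (at 0) \<and>
               ((\<lambda>t. v1 i (x + t *\<^sub>R axis i 1)) has_real_derivative v2 i x) (at 0)))"

lemma twice_diff_onD:
  assumes "twice_diff_on U v v1 v2"
  shows "continuous_on U v" "continuous_on U (v1 i)" "continuous_on U (v2 i)"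
    and "x \<in> U \<Longrightarrow> ((\<lambda>t. v (x + t *\<^sub>R axis i 1)) has_real_derivative v1 i x) (at 0)"
    and "x \<in> U \<Longrightarrow> ((\<lambda>t. v1 i (x + t *\<^sub>R axis i 1)) has_real_derivative v2 i x) (at 0)"
  using assms unfolding twice_diff_on_def by blast+

lemma eventually_axis_shift_in_open:
  fixes z :: "real ^ 'n::finite"
  assumes "open S" "z \<in> S"
  shows "\<forall>\<^sub>F t in nhds (0::real). z + t *\<^sub>R axis i 1 \<in> S"
proof -
  have "((\<lambda>t. z + t *\<^sub>R axis i 1) \<longlongrightarrow> z + 0 *\<^sub>R axis i 1) (nhds (0::real))"
    by (intro tendsto_intros filterlim_ident)
  then have "((\<lambda>t. z + t *\<^sub>R axis i 1) \<longlongrightarrow> z) (nhds (0::real))" by simp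
  then show ?thesis
    by (rule eventually_compose_filterlim[rotated]) (rule eventually_nhds_in_open[OF assms])
qed

lemma DERIV_axis_cong:
  fixes U :: "(real ^ 'n::finite) set"
  assumes "open U" "z \<in> U" "\<And>x. x \<in> U \<Longrightarrow> g x = f x"
    and "((\<lambda>t. f (z + t *\<^sub>R axis i 1)) has_real_derivative D) (at 0)"
  shows "((\<lambda>t. g (z + t *\<^sub>R axis i 1)) has_real_derivative D) (at 0)"
proof -
  have "\<forall>\<^sub>F t in nhds (0::real). g (z + t *\<^sub>R axis i 1) = f (z + t *\<^sub>R axis i 1)"
    using eventually_axis_shift_in_open[OF assms(1,2), of i] by eventually_elim (rule assms(3))
  from DERIV_cong_ev[OF refl this refl] assms(4) show ?thesis by blast
qed

lemma twice_diff_on_subset: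
  assumes "twice_diff_on U v v1 v2" "V \<subseteq> U"
  shows "twice_diff_on V v v1 v2"
  using assms unfolding twice_diff_on_def by (meson continuous_on_subset subsetD)

lemma twice_diff_on_cong:
  assumes "open U" "twice_diff_on U v v1 v2"
    and eq: "\<And>x. x \<in> U \<Longrightarrow> w x = v x" "\<And>i x. x \<in> U \<Longrightarrow> w1 i x = v1 i x" "\<And>i x. x \<in> U \<Longrightarrow> w2 i x = v2 i x"
  shows "twice_diff_on U w w1 w2"
  unfolding twice_diff_on_def
proof (intro conjI allI ballI)
  note vD = twice_diff_onD[OF assms(2)]
  show "continuous_on U w" using vD(1) by (rule continuous_on_eq) (simp add: eq)
  show "continuous_on U (w1 i)" for i using vD(2) by (rule continuous_on_eq) (simp add: eq)
  show "continuous_on U (w2 i)" for i using vD(3) by (rule continuous_on_eq) (simp add: eq)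
  fix i x assume x: "x \<in> U"
  show "((\<lambda>t. w (x + t *\<^sub>R axis i 1)) has_real_derivative w1 i x) (at 0)"
    unfolding eq(2)[OF x] by (rule DERIV_axis_cong[OF assms(1) x eq(1) vD(4)[OF x]])
  show "((\<lambda>t. w1 i (x + t *\<^sub>R axis i 1)) has_real_derivative w2 i x) (at 0)"
    unfolding eq(3)[OF x] by (rule DERIV_axis_cong[OF assms(1) x eq(2) vD(5)[OF x]])
qed

lemma twice_diff_on_open_Un:
  assumes "twice_diff_on A v v1 v2" "twice_diff_on B v v1 v2" "open A" "open B"
  shows "twice_diff_on (A \<union> B) v v1 v2"
  using assms unfolding twice_diff_on_def by (auto intro: continuous_on_open_Un)

lemma twice_diff_on_const: "twice_diff_on U (\<lambda>_. c) (\<lambda>_ _. 0) (\<lambda>_ _. 0)"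
  by (simp add: twice_diff_on_def)

text \<open>
  This makes a truncated function, which is zero near the boundary of an arbitrary open set,
  a function on the whole space, where integration by parts has no boundary terms.
\<close>

lemma twice_diff_on_extend_zero:
  assumes v: "twice_diff_on V v v1 v2" and V: "open V" and K: "closed K" "K \<subseteq> V"
    and zero: "\<And>x. x \<in> V - K \<Longrightarrow> v x = 0" "\<And>i x. x \<in> V - K \<Longrightarrow> v1 i x = 0"
      "\<And>i x. x \<in> V - K \<Longrightarrow> v2 i x = 0"
  shows "twice_diff_on UNIV (\<lambda>x. if x \<in> V then v x else 0) (\<lambda>i x. if x \<in> V then v1 i x else 0)
    (\<lambda>i x. if x \<in> V then v2 i x else 0)"
    (is "twice_diff_on _ ?v ?v1 ?v2")
proof -
  have "twice_diff_on V ?v ?v1 ?v2"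
    by (rule twice_diff_on_cong[OF V v]) auto
  moreover have "twice_diff_on (- K) ?v ?v1 ?v2"
    by (rule twice_diff_on_cong[OF _ twice_diff_on_const[of _ 0]]) (use K zero in auto)
  ultimately have "twice_diff_on (V \<union> - K) ?v ?v1 ?v2"
    by (rule twice_diff_on_open_Un) (use V K in auto)
  moreover have "V \<union> - K = UNIV" using K by auto
  ultimately show ?thesis by simp
qed

lemma twice_diff_on_add:
  assumes "twice_diff_on U v v1 v2" "twice_diff_on U w w1 w2"
  shows "twice_diff_on U (\<lambda>x. v x + w x) (\<lambda>i x. v1 i x + w1 i x) (\<lambda>i x. v2 i x + w2 i x)"
  using assms unfolding twice_diff_on_def
  by (auto intro!: continuous_intros DERIV_add)

lemma twice_diff_on_cmult:
  assumes "twice_diff_on U v v1 v2"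
  shows "twice_diff_on U (\<lambda>x. c * v x) (\<lambda>i x. c * v1 i x) (\<lambda>i x. c * v2 i x)"
  using assms unfolding twice_diff_on_def
  by (auto intro!: continuous_intros DERIV_cmult)

lemma has_real_derivative_pos_part_power:
  assumes "k \<ge> 1"
  shows "((\<lambda>s. (max 0 s) ^ Suc k) has_real_derivative real (Suc k) * (max 0 s) ^ k) (at (s::real))"
proof -
  consider "s > 0" | "s < 0" | "s = 0" by linarith
  then show ?thesis
  proof cases
    case 1
    have "((\<lambda>s. s ^ Suc k) has_real_derivative real (Suc k) * s ^ k) (at s)"
      by (auto intro!: derivative_eq_intros simp del: power_Suc)
    moreover have "\<forall>\<^sub>F t in nhds s. t ^ Suc k = (max 0 t) ^ Suc k"
      using eventually_nhds_in_open[of "{0<..}" s] 1 by (auto elim!: eventually_mono simp del: power_Suc)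
    ultimately show ?thesis using 1 by (subst DERIV_cong_ev[symmetric]) auto
  next
    case 2
    have "((\<lambda>s. 0) has_real_derivative 0) (at s)" by simp
    moreover have "\<forall>\<^sub>F t in nhds s. 0 = (max 0 t) ^ Suc k"
      using eventually_nhds_in_open[of "{..<0}" s] 2 by (auto elim!: eventually_mono)
    ultimately have "((\<lambda>s. (max 0 s) ^ Suc k) has_real_derivative 0) (at s)"
      by (subst DERIV_cong_ev[OF refl _ refl, of _ "\<lambda>_. 0"]) (auto elim: eventually_mono)
    moreover have "real (Suc k) * (max 0 s) ^ k = 0" using 2 assms by simp
    ultimately show ?thesis by (simp only:)
  next
    case 3
    have "((\<lambda>h. (max 0 h) ^ k) \<longlongrightarrow> (max 0 0) ^ k) (at (0::real))"
      by (intro tendsto_intros)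
    moreover have "(max 0 0) ^ k = (0::real)" using assms by simp
    ultimately have "((\<lambda>h. (max 0 h) ^ k) \<longlongrightarrow> 0) (at (0::real))" by (simp only:)
    then have "((\<lambda>h. (max 0 (0+h) ^ Suc k - (max 0 0) ^ Suc k) / h) \<longlongrightarrow> 0) (at (0::real))"
    proof (rule tendsto_cong[THEN iffD1, rotated])
      show "\<forall>\<^sub>F h in at (0::real). (max 0 h) ^ k = (max 0 (0+h) ^ Suc k - (max 0 0) ^ Suc k) / h"
        unfolding eventually_at by (rule exI[of _ 1]) (use assms in \<open>auto simp: max_def\<close>)
    qed
    then have "((\<lambda>s. (max 0 s) ^ Suc k) has_real_derivative 0) (at (0::real))"
      by (simp only: DERIV_def)
    moreover have "real (Suc k) * (max 0 s) ^ k = 0" using 3 assms by simp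
    ultimately show ?thesis using 3 by (simp only:)
  qed
qed

text \<open>
  The cube is the smallest power of the positive part with a continuous second derivative. As it is
  convex, the first term of the second derivative is nonnegative and only helps subharmonicity.
\<close>

lemma twice_diff_on_cube_pos_part:
  assumes "twice_diff_on U z z1 z2"
  shows "twice_diff_on U (\<lambda>x. (max 0 (z x)) ^ 3) (\<lambda>i x. 3 * (max 0 (z x))\<^sup>2 * z1 i x)
     (\<lambda>i x. 6 * max 0 (z x) * (z1 i x)\<^sup>2 + 3 * (max 0 (z x))\<^sup>2 * z2 i x)"
  unfolding twice_diff_on_def
proof (intro conjI allI ballI)
  note zD = twice_diff_onD[OF assms]
  fix i x assume x: "x \<in> U"
  have d3: "((\<lambda>s. (max 0 s) ^ 3) has_real_derivative 3 * (max 0 s)\<^sup>2) (at s)" for s :: real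
    using has_real_derivative_pos_part_power[of 2 s] by (simp add: eval_nat_numeral)
  have d2: "((\<lambda>s. (max 0 s) ^ 2) has_real_derivative 2 * max 0 s) (at s)" for s :: real
    using has_real_derivative_pos_part_power[of 1 s] by (simp add: eval_nat_numeral)
  have x0: "x + 0 *\<^sub>R axis j 1 = x" for j by simp
  show "((\<lambda>t. (max 0 (z (x + t *\<^sub>R axis i 1))) ^ 3) has_real_derivative 3 * (max 0 (z x))\<^sup>2 * z1 i x) (at 0)"
    using DERIV_chain2[OF d3 zD(4)[OF x]] unfolding x0 .
  have "((\<lambda>t. (max 0 (z (x + t *\<^sub>R axis i 1))) ^ 2) has_real_derivative 2 * max 0 (z x) * z1 i x) (at 0)"
    using DERIV_chain2[OF d2 zD(4)[OF x]] unfolding x0 .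
  from DERIV_mult[OF DERIV_cmult[OF this, of 3] zD(5)[OF x]]
  show "((\<lambda>t. 3 * (max 0 (z (x + t *\<^sub>R axis i 1)))\<^sup>2 * z1 i (x + t *\<^sub>R axis i 1)) has_real_derivative
      6 * max 0 (z x) * (z1 i x)\<^sup>2 + 3 * (max 0 (z x))\<^sup>2 * z2 i x) (at 0)"
    by (rule DERIV_cong) (simp add: power2_eq_square algebra_simps)
qed (intro continuous_intros twice_diff_onD[OF assms])+

lemma continuous_on_laplacian:
  assumes "twice_diff_on U v v1 v2"
  shows "continuous_on U (\<lambda>z. \<Sum>i\<in>UNIV. v2 i z)"
  by (intro continuous_on_sum twice_diff_onD(3)[OF assms])

section \<open>Integrals of compactly supported functions\<close>

lemma integral_UNIV_eq_cbox:
  fixes f :: "'a::euclidean_space \<Rightarrow> real"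
  assumes "\<And>x. x \<notin> cbox a b \<Longrightarrow> f x = 0"
  shows "integral UNIV f = integral (cbox a b) f"
proof -
  have "(\<lambda>x. if x \<in> cbox a b then f x else 0) = f" using assms by auto
  then show ?thesis by (metis integral_restrict_UNIV)
qed

lemma cball_subset_some_cbox:
  fixes x0 :: "'a::euclidean_space"
  obtains a b where "cball x0 \<rho> \<subseteq> cbox a b"
  using bounded_cball bounded_subset_cbox_symmetric by metis

lemma integrable_UNIV_of_continuous_on:
  fixes f :: "'a::euclidean_space \<Rightarrow> real"
  assumes "continuous_on UNIV f" "\<And>x. x \<notin> cball x0 \<rho> \<Longrightarrow> f x = 0"
  shows "f integrable_on UNIV"
proof -
  obtain a b where ab: "cball x0 \<rho> \<subseteq> cbox a b" by (rule cball_subset_some_cbox)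
  have "f integrable_on cbox a b"
    by (rule integrable_continuous) (use assms in \<open>blast intro: continuous_on_subset\<close>)
  then have "(\<lambda>x. if x \<in> cbox a b then f x else 0) integrable_on UNIV"
    by (simp add: integrable_restrict_UNIV)
  moreover have "(\<lambda>x. if x \<in> cbox a b then f x else 0) = f" using assms(2) ab by fastforce
  ultimately show ?thesis by simp
qed

lemma integral_UNIV_translate:
  fixes f :: "'a::euclidean_space \<Rightarrow> real"
  assumes "\<And>x. x \<notin> cball x0 \<rho> \<Longrightarrow> f x = 0"
  shows "integral UNIV (\<lambda>x. f (x + c)) = integral UNIV f"
proof -
  obtain a b where ab: "cball x0 \<rho> \<subseteq> cbox a b" by (rule cball_subset_some_cbox)
  have 1: "integral UNIV f = integral (cbox a b) f"
    using ab assms by (intro integral_UNIV_eq_cbox) blast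
  have "x + c \<notin> cbox a b" if "x \<notin> cbox (a - c) (b - c)" for x
    using that by (auto simp: mem_box algebra_simps)
  then have 2: "integral UNIV (\<lambda>x. f (x + c)) = integral (cbox (a - c) (b - c)) (\<lambda>x. f (x + c))"
    using ab assms by (intro integral_UNIV_eq_cbox) blast
  show ?thesis unfolding 1 2 by (rule integral_shift_cbox)
qed

text \<open>
  The integral of \<open>x \<mapsto> g (x + t e\<^sub>i)\<close> does not depend on \<open>t\<close>; differentiating under the integral
  sign at \<open>t = 0\<close> gives the claim.
\<close>

lemma integral_partial_derivative_eq_0:
  fixes g g' :: "real ^ 'n::finite \<Rightarrow> real"
  assumes cont: "continuous_on UNIV g" "continuous_on UNIV g'"
    and der: "\<And>x. ((\<lambda>t. g (x + t *\<^sub>R axis i 1)) has_real_derivative g' x) (at 0)"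
    and supp: "\<And>x. x \<notin> cball x0 \<rho> \<Longrightarrow> g x = 0" "\<And>x. x \<notin> cball x0 \<rho> \<Longrightarrow> g' x = 0"
  shows "integral UNIV g' = 0"
proof -
  let ?e = "axis i 1 :: real ^ 'n"
  obtain a b where ab: "cball x0 (\<rho> + 1) \<subseteq> cbox a b" by (rule cball_subset_some_cbox)
  have der_t: "((\<lambda>t. g (x + t *\<^sub>R ?e)) has_real_derivative g' (x + t *\<^sub>R ?e)) (at t)" for x t
  proof -
    have "((\<lambda>s. g (x + t *\<^sub>R ?e + s *\<^sub>R ?e)) has_real_derivative g' (x + t *\<^sub>R ?e)) (at 0)" by (rule der)
    then show ?thesis
      using DERIV_shift[of "\<lambda>s. g (x + s *\<^sub>R ?e)" "g' (x + t *\<^sub>R ?e)" 0 t]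
      by (simp add: algebra_simps)
  qed
  define h where "h t = integral (cbox a b) (\<lambda>x. g (x + t *\<^sub>R ?e))" for t
  have cont_shift: "continuous_on A (\<lambda>x. g (x + t *\<^sub>R ?e))" for t A
    by (intro continuous_on_compose2[OF cont(1)] continuous_intros) auto
  have "((\<lambda>t. integral (cbox a b) (\<lambda>x. g (x + t *\<^sub>R ?e))) has_real_derivative
       integral (cbox a b) (\<lambda>x. g' (x + 0 *\<^sub>R ?e))) (at 0 within UNIV)"
  proof (rule leibniz_rule_field_derivative)
    show "continuous_on (UNIV \<times> cbox a b) (\<lambda>(t, x). g' (x + t *\<^sub>R ?e))"
      unfolding case_prod_beta
      by (intro continuous_on_compose2[OF cont(2)] continuous_intros) auto
  qed (auto intro!: integrable_continuous cont_shift der_t)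
  then have hder: "(h has_real_derivative integral (cbox a b) g') (at 0)" by (simp add: h_def[abs_def])
  have hconst: "h t = integral UNIV g" if "\<bar>t\<bar> < 1" for t
  proof -
    have "integral UNIV (\<lambda>x. g (x + t *\<^sub>R ?e)) = h t"
      unfolding h_def
    proof (rule integral_UNIV_eq_cbox)
      fix x assume "x \<notin> cbox a b"
      then have "dist x0 x > \<rho> + 1" using ab by (meson mem_cball not_le subsetD)
      moreover have "dist x (x + t *\<^sub>R ?e) < 1" using that by (simp add: dist_norm)
      ultimately have "x + t *\<^sub>R ?e \<notin> cball x0 \<rho>"
        using dist_triangle[of x0 x "x + t *\<^sub>R ?e"] by (auto simp: dist_commute)
      then show "g (x + t *\<^sub>R ?e) = 0" by (rule supp)
    qed
    then show ?thesis using integral_UNIV_translate[of x0 \<rho> g "t *\<^sub>R ?e"] supp by simp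
  qed
  have "((\<lambda>t. integral UNIV g) has_real_derivative integral (cbox a b) g') (at 0)"
    using hder by (rule DERIV_cong_ev[THEN iffD1, rotated -1])
      (auto intro!: eventually_nhds_metric[THEN iffD2] exI[of _ 1] hconst simp: dist_norm)
  then have "integral (cbox a b) g' = 0" using DERIV_const DERIV_unique by blast
  moreover have "integral UNIV g' = integral (cbox a b) g'"
  proof (rule integral_UNIV_eq_cbox)
    fix x assume "x \<notin> cbox a b"
    then have "dist x0 x > \<rho> + 1" using ab by (meson mem_cball not_le subsetD)
    then show "g' x = 0" by (intro supp) auto
  qed
  ultimately show ?thesis by simp
qed

text \<open>
  The factor \<open>v\<close> is only controlled on \<open>U\<close>, and its values elsewhere are arbitrary; they are multiplied
  by zero. This allows integrals over the whole space for functions that live on \<open>U\<close>.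
\<close>

lemma continuous_on_mult_supported:
  fixes v k :: "'a::t2_space \<Rightarrow> real"
  assumes "open U" "continuous_on U v" "continuous_on UNIV k" "closed K" "K \<subseteq> U"
    and "\<And>x. x \<notin> K \<Longrightarrow> k x = 0"
  shows "continuous_on UNIV (\<lambda>x. v x * k x)"
proof -
  have "continuous_on U (\<lambda>x. v x * k x)"
    using assms by (auto intro!: continuous_intros intro: continuous_on_subset)
  moreover have "continuous_on (-K) (\<lambda>x. v x * k x)"
    by (rule continuous_on_cong[THEN iffD2, OF refl, of _ _ "\<lambda>_. 0"]) (use assms in auto)
  ultimately have "continuous_on (U \<union> -K) (\<lambda>x. v x * k x)"
    using assms by (intro continuous_on_open_Un) auto
  moreover have "U \<union> -K = UNIV" using assms by auto
  ultimately show ?thesis by simp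
qed

section \<open>Quadratic bumps and their Laplacian\<close>

text \<open>
  The parameter \<open>r\<close> is the square of the radius of the support: then \<open>\<partial>/\<partial>r\<close> just lowers the power,
  and the Laplacian of the cube is a combination of the lower powers with coefficients linear in \<open>r\<close>.
\<close>

definition bump :: "nat \<Rightarrow> real ^ 'n::finite \<Rightarrow> real \<Rightarrow> real ^ 'n \<Rightarrow> real" where
  "bump k x0 r z = (max 0 (r - (norm (z - x0))\<^sup>2)) ^ k"

lemma bump_nonneg: "0 \<le> bump k x0 r z"
  by (simp add: bump_def)

lemma bump_eq_0:
  assumes "k \<ge> 1" "0 \<le> \<rho>" "r \<le> \<rho>\<^sup>2" "z \<notin> cball x0 \<rho>"
  shows "bump k x0 r z = 0"
proof -
  have "\<rho> \<le> norm (z - x0)" using assms by (auto simp: dist_norm norm_minus_commute)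
  then have "\<rho>\<^sup>2 \<le> (norm (z - x0))\<^sup>2" using assms by (intro power_mono) auto
  then have "max 0 (r - (norm (z - x0))\<^sup>2) = 0" using assms(3) by linarith
  then show ?thesis using assms(1) by (simp add: bump_def)
qed

lemma continuous_on_bump [continuous_intros]:
  fixes f :: "'a::topological_space \<Rightarrow> real" and g :: "'a \<Rightarrow> real ^ 'n::finite"
  assumes "continuous_on A f" "continuous_on A g"
  shows "continuous_on A (\<lambda>x. bump k x0 (f x) (g x))"
  unfolding bump_def by (intro continuous_intros assms)

lemma bump_deriv_radius:
  assumes "k \<ge> 1"
  shows "((\<lambda>r. bump (Suc k) x0 r z) has_real_derivative real (Suc k) * bump k x0 r z) (at r)"
proof -
  have "((\<lambda>r. r - (norm (z - x0))\<^sup>2) has_real_derivative 1) (at r)"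
    by (auto intro!: derivative_eq_intros)
  from DERIV_chain2[OF has_real_derivative_pos_part_power[OF assms] this]
  show ?thesis by (simp add: bump_def del: power_Suc)
qed

lemma norm_power2_axis_shift:
  "(norm (y + t *\<^sub>R axis i 1 :: real ^ 'n::finite))\<^sup>2 = (norm y)\<^sup>2 + 2 * t * y $ i + t\<^sup>2"
  unfolding power2_norm_eq_inner
  by (simp add: inner_add_left inner_add_right inner_axis inner_axis' power2_eq_square algebra_simps)

lemma bump_deriv_axis:
  assumes "k \<ge> 1"
  shows "((\<lambda>t. bump (Suc k) x0 r (z + t *\<^sub>R axis i 1)) has_real_derivative
           - (2 * real (Suc k) * (z - x0) $ i * bump k x0 r z)) (at 0)"
proof -
  have eq: "(norm (z + t *\<^sub>R axis i 1 - x0))\<^sup>2 = (norm (z - x0))\<^sup>2 + 2 * t * (z - x0) $ i + t\<^sup>2" for t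
    using norm_power2_axis_shift[of "z - x0" t i] by (simp add: algebra_simps)
  have "((\<lambda>t. r - (norm (z + t *\<^sub>R axis i 1 - x0))\<^sup>2) has_real_derivative - (2 * (z - x0) $ i)) (at 0)"
    unfolding eq by (auto intro!: derivative_eq_intros)
  from DERIV_chain2[OF has_real_derivative_pos_part_power[OF assms] this]
  show ?thesis by (simp add: bump_def algebra_simps del: power_Suc)
qed

abbreviation bump_integral where
  "bump_integral v k x0 r \<equiv> integral UNIV (\<lambda>z. v z * bump k x0 r z)"

lemma continuous_on_mult_bump:
  assumes "open U" "continuous_on U v" "cball x0 \<rho> \<subseteq> U" "0 \<le> \<rho>" "r \<le> \<rho>\<^sup>2" "k \<ge> 1"
  shows "continuous_on UNIV (\<lambda>z. v z * bump k x0 r z)"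
  by (rule continuous_on_mult_supported[OF assms(1,2) _ closed_cball assms(3)])
    (use assms bump_eq_0 in \<open>auto intro!: continuous_intros\<close>)

lemma integrable_mult_bump:
  assumes "open U" "continuous_on U v" "cball x0 \<rho> \<subseteq> U" "0 \<le> \<rho>" "r \<le> \<rho>\<^sup>2" "k \<ge> 1"
  shows "(\<lambda>z. v z * bump k x0 r z) integrable_on UNIV"
  by (rule integrable_UNIV_of_continuous_on[where ?x0.0=x0 and \<rho>=\<rho>])
    (use assms in \<open>auto intro!: continuous_on_mult_bump[OF assms] bump_eq_0\<close>)

lemma bump_integral_mono:
  assumes "open U" "continuous_on U v" "continuous_on U w" "cball x0 \<rho> \<subseteq> U" "0 \<le> \<rho>" "r \<le> \<rho>\<^sup>2" "k \<ge> 1"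
    and le: "\<And>z. z \<in> cball x0 \<rho> \<Longrightarrow> bump k x0 r z > 0 \<Longrightarrow> v z \<le> w z"
  shows "bump_integral v k x0 r \<le> bump_integral w k x0 r"
proof (rule integral_le)
  fix z
  show "v z * bump k x0 r z \<le> w z * bump k x0 r z"
  proof (cases "z \<in> cball x0 \<rho> \<and> bump k x0 r z > 0")
    case True then show ?thesis using le by (simp add: mult_right_mono)
  next
    case False
    then have "bump k x0 r z = 0" using bump_eq_0[OF assms(7,5,6)] bump_nonneg[of k x0 r z] by force
    then show ?thesis by simp
  qed
qed (use assms in \<open>auto intro!: integrable_mult_bump\<close>)

lemma bump_integral_deriv:
  assumes U: "open U" "continuous_on U v" "cball x0 \<rho> \<subseteq> U" "0 \<le> \<rho>" and r: "r < \<rho>\<^sup>2" "0 < r"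
  shows "((\<lambda>r. bump_integral v 2 x0 r) has_real_derivative 2 * bump_integral v 1 x0 r) (at r)"
proof -
  let ?R = "{0<..<\<rho>\<^sup>2}"
  obtain a b where ab: "cball x0 \<rho> \<subseteq> cbox a b" by (rule cball_subset_some_cbox)
  have box: "bump_integral v k x0 s = integral (cbox a b) (\<lambda>z. v z * bump k x0 s z)"
    if "s \<le> \<rho>\<^sup>2" "k \<ge> 1" for s k
  proof (rule integral_UNIV_eq_cbox)
    fix z assume "z \<notin> cbox a b"
    then have "z \<notin> cball x0 \<rho>" using ab by blast
    from bump_eq_0[OF that(2) U(4) that(1) this] show "v z * bump k x0 s z = 0" by simp
  qed
  have "((\<lambda>s. integral (cbox a b) (\<lambda>z. v z * bump 2 x0 s z)) has_real_derivative
      integral (cbox a b) (\<lambda>z. 2 * (v z * bump 1 x0 r z))) (at r within ?R)"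
  proof (rule leibniz_rule_field_derivative)
    fix s z
    have "((\<lambda>s. bump (Suc 1) x0 s z) has_real_derivative real (Suc 1) * bump 1 x0 s z) (at s)"
      by (rule bump_deriv_radius) simp
    from DERIV_cmult[OF this, of "v z"]
    have "((\<lambda>s. v z * bump 2 x0 s z) has_real_derivative 2 * (v z * bump 1 x0 s z)) (at s)"
      by (simp add: numeral_2_eq_2 mult.left_commute)
    then show "((\<lambda>s. v z * bump 2 x0 s z) has_real_derivative 2 * (v z * bump 1 x0 s z)) (at s within ?R)"
      by (rule has_field_derivative_at_within)
  next
    fix s assume "s \<in> ?R"
    then have "s \<le> \<rho>\<^sup>2" by simp
    show "(\<lambda>z. v z * bump 2 x0 s z) integrable_on cbox a b"
      by (rule integrable_continuous, rule continuous_on_subset[OF continuous_on_mult_bump[OF U \<open>s \<le> \<rho>\<^sup>2\<close>]]) auto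
  next
    \<comment> \<open>Cutting the parameter off at \<open>\<rho>\<^sup>2\<close> keeps all supports inside \<open>U\<close>, where \<open>v\<close> is continuous.\<close>
    have "continuous_on UNIV (\<lambda>p. v (snd p) * bump 1 x0 (min (fst p) (\<rho>\<^sup>2)) (snd p))"
    proof (rule continuous_on_mult_supported[where U = "UNIV \<times> U" and K = "UNIV \<times> cball x0 \<rho>"])
      show "continuous_on (UNIV \<times> U) (\<lambda>p. v (snd p))"
        by (rule continuous_on_compose2[OF U(2)]) (auto intro!: continuous_intros)
      show "bump 1 x0 (min (fst p) (\<rho>\<^sup>2)) (snd p) = 0"
        if "p \<notin> (UNIV::real set) \<times> cball x0 \<rho>" for p
        by (rule bump_eq_0[OF _ U(4)]) (use that in \<open>auto simp: mem_Times_iff\<close>)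
    qed (use U in \<open>auto intro!: continuous_intros open_Times closed_Times\<close>)
    then have "continuous_on (?R \<times> cbox a b) (\<lambda>p. 2 * (v (snd p) * bump 1 x0 (min (fst p) (\<rho>\<^sup>2)) (snd p)))"
      by (rule continuous_on_mult_left[OF continuous_on_subset[OF _ subset_UNIV]])
    then show "continuous_on (?R \<times> cbox a b) (\<lambda>(s, z). 2 * (v z * bump 1 x0 s z))"
      by (rule continuous_on_cong[THEN iffD1, OF refl, rotated]) (auto simp: min_def)
  qed (use r in auto)
  then have "((\<lambda>s. integral (cbox a b) (\<lambda>z. v z * bump 2 x0 s z)) has_real_derivative
      integral (cbox a b) (\<lambda>z. 2 * (v z * bump 1 x0 r z))) (at r)"
    using r by (subst (asm) at_within_open) auto
  moreover have "integral (cbox a b) (\<lambda>z. 2 * (v z * bump 1 x0 r z)) = 2 * bump_integral v 1 x0 r"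
    using r by (simp add: box)
  moreover have "\<forall>\<^sub>F s in nhds r. bump_integral v 2 x0 s = integral (cbox a b) (\<lambda>z. v z * bump 2 x0 s z)"
    using eventually_nhds_in_open[of ?R r] r by (auto elim!: eventually_mono intro!: box)
  ultimately show ?thesis by (subst DERIV_cong_ev) auto
qed

text \<open>
  Integration by parts twice moves the Laplacian to \<open>(r - q)\<^sub>+\<^sup>3\<close> with \<open>q = |z - x\<^sub>0|\<^sup>2\<close>. There
  \<open>\<partial>\<^sub>i\<^sup>2\<close> gives \<open>24 (z - x\<^sub>0)\<^sub>i\<^sup>2 (r - q)\<^sub>+ - 6 (r - q)\<^sub>+\<^sup>2\<close>. Summing over \<open>i\<close> and using
  \<open>q (r - q)\<^sub>+ = r (r - q)\<^sub>+ - (r - q)\<^sub>+\<^sup>2\<close> gives the right-hand side.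
\<close>

lemma laplacian_bump_integral:
  fixes v :: "real ^ 'n::finite \<Rightarrow> real"
  assumes v: "twice_diff_on U v v1 v2" and U: "open U" "cball x0 \<rho> \<subseteq> U" "0 \<le> \<rho>" and r: "r \<le> \<rho>\<^sup>2"
  shows "bump_integral (\<lambda>z. \<Sum>i\<in>UNIV. v2 i z) 3 x0 r =
     24 * r * bump_integral v 1 x0 r - (24 + 6 * real CARD('n)) * bump_integral v 2 x0 r"
proof -
  note vD = twice_diff_onD[OF v]
  define D2 where "D2 i z = 24 * ((z - x0) $ i)\<^sup>2 * bump 1 x0 r z - 6 * bump 2 x0 r z" for i z
  have supp: "bump k x0 r z = 0" if "z \<notin> cball x0 \<rho>" "k \<ge> 1" for k z
    using bump_eq_0[OF that(2) U(3) r that(1)] .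
  have contD: "continuous_on UNIV (\<lambda>z. v z * D2 i z)" for i
    by (rule continuous_on_mult_supported[OF U(1) vD(1) _ closed_cball U(2)])
      (auto simp: D2_def supp intro!: continuous_intros)
  have intD: "(\<lambda>z. v z * D2 i z) integrable_on UNIV" for i
    by (rule integrable_UNIV_of_continuous_on[OF contD, of x0 \<rho>]) (auto simp: D2_def supp)
  have int2: "(\<lambda>z. v2 i z * bump 3 x0 r z) integrable_on UNIV" for i
    by (rule integrable_mult_bump[OF U(1) vD(3) U(2,3) r]) simp
  have one: "bump_integral (v2 i) 3 x0 r = integral UNIV (\<lambda>z. v z * D2 i z)" for i
  proof -
    \<comment> \<open>The function whose partial derivative is the difference of both integrands; the first-order terms cancel.\<close>
    let ?g = "\<lambda>z. v1 i z * bump 3 x0 r z + v z * (6 * (z - x0) $ i * bump 2 x0 r z)"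
    let ?g' = "\<lambda>z. v2 i z * bump 3 x0 r z - v z * D2 i z"
    have "integral UNIV ?g' = 0"
    proof (rule integral_partial_derivative_eq_0[of ?g _ i x0 \<rho>])
      show "continuous_on UNIV ?g"
        by (intro continuous_on_add continuous_on_mult_bump[OF U(1) vD(2) U(2,3) r]
            continuous_on_mult_supported[OF U(1) vD(1) _ closed_cball U(2)])
          (auto simp: supp intro!: continuous_intros)
      show "continuous_on UNIV ?g'"
        by (intro continuous_on_diff contD continuous_on_mult_bump[OF U(1) vD(3) U(2,3) r]) simp
      fix z
      show "((\<lambda>t. ?g (z + t *\<^sub>R axis i 1)) has_real_derivative ?g' z) (at 0)"
      proof (cases "z \<in> U")
        case True
        have b3: "((\<lambda>t. bump 3 x0 r (z + t *\<^sub>R axis i 1)) has_real_derivative - (6 * (z - x0) $ i * bump 2 x0 r z)) (at 0)"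
          using bump_deriv_axis[of 2 x0 r z i] by (simp add: eval_nat_numeral)
        have b2: "((\<lambda>t. bump 2 x0 r (z + t *\<^sub>R axis i 1)) has_real_derivative - (4 * (z - x0) $ i * bump 1 x0 r z)) (at 0)"
          using bump_deriv_axis[of 1 x0 r z i] by (simp add: eval_nat_numeral)
        have l: "((\<lambda>t. (z + t *\<^sub>R axis i 1 - x0) $ i) has_real_derivative 1) (at 0)"
          by (auto intro!: derivative_eq_intros)
        show ?thesis
          by (rule DERIV_cong[OF DERIV_add[OF DERIV_mult[OF vD(5)[OF True] b3]
                DERIV_mult[OF vD(4)[OF True] DERIV_mult[OF DERIV_cmult[OF l, of 6] b2]]]])
            (simp add: D2_def power2_eq_square algebra_simps)
      next
        case False
        then have "z \<in> - cball x0 \<rho>" using U by auto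
        moreover have "open (- cball x0 \<rho>)" by (simp add: open_Compl)
        ultimately have "\<forall>\<^sub>F t in nhds (0::real). z + t *\<^sub>R axis i 1 \<in> - cball x0 \<rho>"
          by (intro eventually_axis_shift_in_open)
        then have "\<forall>\<^sub>F t in nhds (0::real). ?g (z + t *\<^sub>R axis i 1) = 0"
          by eventually_elim (simp add: supp)
        moreover have "?g' z = 0" using \<open>z \<in> - cball x0 \<rho>\<close> by (simp add: D2_def supp)
        ultimately show ?thesis by (subst DERIV_cong_ev[OF refl _ refl, of _ "\<lambda>_. 0"]) auto
      qed
    qed (auto simp: supp D2_def)
    then show ?thesis using integral_diff[OF int2 intD, of i i] by simp
  qed
  have q: "(\<Sum>i\<in>UNIV. D2 i z) = 24 * r * bump 1 x0 r z - (24 + 6 * real CARD('n)) * bump 2 x0 r z" for z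
  proof -
    have sq: "(\<Sum>i\<in>UNIV. ((z - x0) $ i)\<^sup>2) = (norm (z - x0))\<^sup>2"
      unfolding norm_vec_def L2_set_def by (subst real_sqrt_pow2) (auto intro: sum_nonneg)
    have "(\<Sum>i\<in>UNIV. D2 i z) = 24 * (\<Sum>i\<in>UNIV. ((z - x0) $ i)\<^sup>2) * bump 1 x0 r z - (\<Sum>i\<in>(UNIV::'n set). 6 * bump 2 x0 r z)"
      unfolding D2_def by (simp only: sum_subtractf sum_distrib_left sum_distrib_right)
    then have "(\<Sum>i\<in>UNIV. D2 i z) = 24 * ((norm (z - x0))\<^sup>2 * bump 1 x0 r z) - 6 * real CARD('n) * bump 2 x0 r z"
      unfolding sq by simp
    moreover have "(norm (z - x0))\<^sup>2 * bump 1 x0 r z = r * bump 1 x0 r z - bump 2 x0 r z"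
    proof (cases "r \<le> (norm (z - x0))\<^sup>2")
      case False
      then show ?thesis by (simp add: bump_def max_def power2_eq_square[of "r - _"] algebra_simps)
    qed (simp add: bump_def)
    ultimately show ?thesis by (simp add: algebra_simps)
  qed
  have "bump_integral (\<lambda>z. \<Sum>i\<in>UNIV. v2 i z) 3 x0 r = (\<Sum>i\<in>UNIV. bump_integral (v2 i) 3 x0 r)"
    unfolding sum_distrib_right by (rule integral_sum) (use int2 in auto)
  also have "\<dots> = integral UNIV (\<lambda>z. v z * (\<Sum>i\<in>UNIV. D2 i z))"
    unfolding one sum_distrib_left by (rule integral_sum[symmetric]) (use intD in auto)
  also have "(\<lambda>z. v z * (\<Sum>i\<in>UNIV. D2 i z)) =
      (\<lambda>z. 24 * r * (v z * bump 1 x0 r z) - (24 + 6 * real CARD('n)) * (v z * bump 2 x0 r z))"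
    unfolding q by (rule ext) (simp add: right_diff_distrib)
  also have "integral UNIV \<dots> = 24 * r * bump_integral v 1 x0 r - (24 + 6 * real CARD('n)) * bump_integral v 2 x0 r"
  proof (subst integral_diff)
    show "(\<lambda>z. 24 * r * (v z * bump 1 x0 r z)) integrable_on UNIV"
      by (rule integrable_on_mult_right, rule integrable_mult_bump[OF U(1) vD(1) U(2,3) r]) simp
    show "(\<lambda>z. (24 + 6 * real CARD('n)) * (v z * bump 2 x0 r z)) integrable_on UNIV"
      by (rule integrable_on_mult_right, rule integrable_mult_bump[OF U(1) vD(1) U(2,3) r]) simp
  qed (simp only: integral_mult_right)
  finally show ?thesis .
qed

section \<open>Weighted means over balls\<close>

text \<open>
  The exponent makes the mean of a constant independent of \<open>r\<close>, see \<open>bump_mass\<close>.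
\<close>

definition bump_mean :: "(real ^ 'n::finite \<Rightarrow> real) \<Rightarrow> real ^ 'n \<Rightarrow> real \<Rightarrow> real" where
  "bump_mean v x0 r = r powr (- (real CARD('n) / 2 + 2)) * bump_integral v 2 x0 r"

text \<open>
  With \<open>p = n/2 + 2\<close> and \<open>A = \<integral> v (r - q)\<^sub>+\<^sup>2\<close>, the derivative of \<open>r\<^bsup>-p\<^esup> A\<close> is \<open>r\<^bsup>-p-1\<^esup> (r A' - p A)\<close>, and
  \<open>12 (r A' - p A)\<close> is the integral of the Laplacian in \<open>laplacian_bump_integral\<close>.
\<close>

lemma bump_mean_deriv:
  fixes v :: "real ^ 'n::finite \<Rightarrow> real"
  assumes v: "twice_diff_on U v v1 v2" and U: "open U" "cball x0 \<rho> \<subseteq> U" "0 \<le> \<rho>"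
    and r: "0 < r" "r < \<rho>\<^sup>2"
  shows "(bump_mean v x0 has_real_derivative
     r powr (- (real CARD('n) / 2 + 3)) / 12 * bump_integral (\<lambda>z. \<Sum>i\<in>UNIV. v2 i z) 3 x0 r) (at r)"
proof -
  let ?p = "real CARD('n) / 2 + 2"
  have A: "((\<lambda>r. bump_integral v 2 x0 r) has_real_derivative 2 * bump_integral v 1 x0 r) (at r)"
    by (rule bump_integral_deriv[OF U(1) twice_diff_onD(1)[OF v] U(2,3) r(2,1)])
  have P: "((\<lambda>r. r powr (- ?p)) has_real_derivative (- ?p) * r powr (- ?p - 1)) (at r)"
    by (rule has_real_derivative_powr[OF r(1)])
  have e: "- ?p - 1 = - (real CARD('n) / 2 + 3)" by simp
  have pw: "r powr (- ?p) = r * r powr (- (real CARD('n) / 2 + 3))"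
    unfolding powr_mult_base[OF less_imp_le[OF r(1)]] by (rule arg_cong[where f = "(powr) r"]) simp
  note L = laplacian_bump_integral[OF v U less_imp_le[OF r(2)]]
  show ?thesis
    unfolding bump_mean_def[abs_def]
    by (rule DERIV_cong[OF DERIV_mult[OF P A]], unfold e pw L) (simp add: field_simps)
qed

text \<open>
  The mean of the constant \<open>1\<close> does not depend on the radius because its Laplacian vanishes, and not on
  the centre by translation invariance.
\<close>

lemma bump_mass:
  obtains c where "c > 0" "\<And>(x0::real ^ 'n::finite) r. 0 < r \<Longrightarrow> bump_mean (\<lambda>_. 1) x0 r = c"
proof -
  let ?F = "bump_mean (\<lambda>_. 1) (0::real ^ 'n)"
  have d0: "(?F has_real_derivative 0) (at r)" if "r > 0" for r
  proof -
    have "r < (sqrt r + 1)\<^sup>2" using that by (simp add: power2_eq_square algebra_simps add_pos_nonneg)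
    from bump_mean_deriv[OF twice_diff_on_const[of UNIV "1::real"] open_UNIV _ _ that this, of 0]
    show ?thesis using that by simp
  qed
  have "\<exists>c. \<forall>r\<in>{0<..}. ?F r = c"
    by (rule has_field_derivative_zero_constant)
      (auto intro: has_field_derivative_at_within d0)
  then obtain c where c: "\<And>r. r > 0 \<Longrightarrow> ?F r = c" by auto
  have trans: "bump_mean (\<lambda>_. 1) x0 r = ?F r" if "r > 0" for x0 :: "real ^ 'n" and r
  proof -
    have "integral UNIV (\<lambda>z. bump 2 x0 r (z + x0)) = integral UNIV (bump 2 x0 r)"
      by (rule integral_UNIV_translate[of x0 "sqrt r"]) (rule bump_eq_0, use that in auto)
    then show ?thesis by (simp add: bump_mean_def bump_def[abs_def])
  qed
  have "c > 0"
  proof -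
    let ?B = "cbox (- 1) (1 :: real ^ 'n)"
    have ab: "cball (0::real ^ 'n) 1 \<subseteq> ?B"
    proof
      fix z :: "real ^ 'n" assume "z \<in> cball 0 1"
      then have "\<bar>z $ i\<bar> \<le> 1" for i
        using component_le_norm_cart[of z i] by (simp add: dist_norm)
      then show "z \<in> ?B" by (auto simp: mem_box_cart abs_le_iff minus_le_iff)
    qed
    have i: "integral UNIV (bump 2 (0::real ^ 'n) 1) = integral ?B (bump 2 (0::real ^ 'n) 1)"
    proof (rule integral_UNIV_eq_cbox)
      fix z :: "real ^ 'n" assume "z \<notin> ?B"
      then have "z \<notin> cball 0 1" using ab by blast
      then show "bump 2 0 1 z = 0" by (intro bump_eq_0[of 2 1]) auto
    qed
    have cont: "continuous_on ?B (bump 2 (0::real ^ 'n) 1)" by (intro continuous_intros)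
    have "integral ?B (bump 2 (0::real ^ 'n) 1) \<noteq> 0"
    proof
      assume "integral ?B (bump 2 (0::real ^ 'n) 1) = 0"
      moreover have "box (- 1) (1 :: real ^ 'n) \<noteq> {}"
        by (auto simp: interval_ne_empty_cart)
      ultimately have "\<forall>x\<in>?B. bump 2 (0::real ^ 'n) 1 x = 0"
        by (subst (asm) integral_cbox_eq_0_iff[OF cont]) (auto simp: bump_nonneg)
      moreover have "(0::real ^ 'n) \<in> ?B" using ab by auto
      ultimately show False by (auto simp: bump_def)
    qed
    moreover have "integral ?B (bump 2 (0::real ^ 'n) 1) \<ge> 0"
      by (rule integral_nonneg) (auto simp: bump_nonneg intro!: integrable_continuous cont)
    ultimately show ?thesis using c[of 1] i by (simp add: bump_mean_def)
  qed
  with c trans that show ?thesis by (metis (no_types, lifting))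
qed

lemma bump_mean_mono:
  fixes v :: "real ^ 'n::finite \<Rightarrow> real"
  assumes "open U" "continuous_on U v" "continuous_on U w" "cball x0 \<rho> \<subseteq> U" "0 \<le> \<rho>" "r \<le> \<rho>\<^sup>2"
    and le: "\<And>z. z \<in> cball x0 \<rho> \<Longrightarrow> bump 2 x0 r z > 0 \<Longrightarrow> v z \<le> w z"
  shows "bump_mean v x0 r \<le> bump_mean w x0 r"
  unfolding bump_mean_def
  by (intro mult_left_mono bump_integral_mono[OF assms(1-6)] le) auto

lemma bump_mean_const: "bump_mean (\<lambda>_. c) x0 r = c * bump_mean (\<lambda>_. 1) x0 r"
  by (simp add: bump_mean_def)

lemma bump_mean_tendsto:
  fixes v :: "real ^ 'n::finite \<Rightarrow> real"
  assumes "open U" "continuous_on U v" "x0 \<in> U"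
    and c: "\<And>(x0::real ^ 'n::finite) r. 0 < r \<Longrightarrow> bump_mean (\<lambda>_. 1) x0 r = c" "c > 0"
  shows "(bump_mean v x0 \<longlongrightarrow> c * v x0) (at_right 0)"
proof (rule tendstoI)
  fix e :: real assume e: "e > 0"
  define e' where "e' = e / (2 * c)"
  have "e' > 0" using e c by (simp add: e'_def)
  have "isCont v x0" using assms continuous_on_eq_continuous_at by blast
  then have "\<forall>\<^sub>F z in nhds x0. dist (v z) (v x0) < e'"
    unfolding isCont_def tendsto_at_iff_tendsto_nhds by (rule tendstoD) (rule \<open>e' > 0\<close>)
  moreover have "\<forall>\<^sub>F z in nhds x0. z \<in> U" using assms by (intro eventually_nhds_in_open)
  ultimately have "\<forall>\<^sub>F z in nhds x0. z \<in> U \<and> dist (v z) (v x0) < e'" by (rule eventually_conj[rotated])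
  then obtain d where d: "d > 0" "\<And>z. dist z x0 < d \<Longrightarrow> z \<in> U \<and> dist (v z) (v x0) < e'"
    unfolding eventually_nhds_metric by blast
  let ?\<rho> = "d / 2"
  have sub: "cball x0 ?\<rho> \<subseteq> U" using d by (auto simp: dist_commute)
  have "dist (bump_mean v x0 r) (c * v x0) < e" if r: "0 < r" "r < ?\<rho>\<^sup>2" for r
  proof -
    have close: "v x0 - e' \<le> v z \<and> v z \<le> v x0 + e'" if "z \<in> cball x0 ?\<rho>" for z
    proof -
      have "dist (v z) (v x0) < e'" using that d(1) d(2)[of z] by (auto simp: dist_commute)
      then show ?thesis unfolding dist_real_def by linarith
    qed
    have "bump_mean (\<lambda>_. v x0 - e') x0 r \<le> bump_mean v x0 r"
      by (rule bump_mean_mono[OF assms(1) _ assms(2) sub]) (use close r d in auto)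
    moreover have "bump_mean v x0 r \<le> bump_mean (\<lambda>_. v x0 + e') x0 r"
      by (rule bump_mean_mono[OF assms(1,2) _ sub]) (use close r d in auto)
    ultimately have "(v x0 - e') * c \<le> bump_mean v x0 r" "bump_mean v x0 r \<le> (v x0 + e') * c"
      unfolding bump_mean_const[of "v x0 - e'"] bump_mean_const[of "v x0 + e'"] c(1)[OF r(1)] by auto
    moreover have "e' * c = e / 2" using c by (simp add: e'_def)
    ultimately show ?thesis using e by (auto simp: dist_real_def algebra_simps)
  qed
  then show "\<forall>\<^sub>F r in at_right 0. dist (bump_mean v x0 r) (c * v x0) < e"
    unfolding eventually_at_right_field using d by (intro exI[of _ "?\<rho>\<^sup>2"]) auto
qed

lemma limit_at_right_le_of_deriv_nonneg:
  fixes G :: "real \<Rightarrow> real"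
  assumes der: "\<And>s. 0 < s \<Longrightarrow> s \<le> r \<Longrightarrow> (G has_real_derivative G' s) (at s)"
    and nonneg: "\<And>s. 0 < s \<Longrightarrow> s \<le> r \<Longrightarrow> 0 \<le> G' s"
    and lim: "(G \<longlongrightarrow> l) (at_right 0)" and r: "0 < r"
  shows "l \<le> G r"
proof (rule tendsto_upperbound[OF lim])
  have "G s \<le> G r" if "0 < s" "s < r" for s
  proof (rule DERIV_nonneg_imp_nondecreasing[of s r G])
    fix x assume "s \<le> x" "x \<le> r"
    then show "\<exists>y. (G has_real_derivative y) (at x) \<and> 0 \<le> y"
      using that der[of x] nonneg[of x] by (intro exI[of _ "G' x"]) auto
  qed (use that in auto)
  then show "\<forall>\<^sub>F s in at_right 0. G s \<le> G r"
    unfolding eventually_at_right_field using r by blast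
qed simp

lemma bump_integral3_le:
  fixes v :: "real ^ 'n::finite \<Rightarrow> real"
  assumes U: "open U" "continuous_on U v" "cball x0 \<rho> \<subseteq> U" "0 \<le> \<rho>" and r: "0 < r" "r \<le> \<rho>\<^sup>2"
    and nn: "\<And>z. z \<in> cball x0 \<rho> \<Longrightarrow> 0 \<le> v z"
  shows "r powr (- (real CARD('n) / 2 + 3)) * bump_integral v 3 x0 r \<le> bump_mean v x0 r"
proof -
  have "bump_integral v 3 x0 r \<le> integral UNIV (\<lambda>z. r * (v z * bump 2 x0 r z))"
  proof (rule integral_le)
    fix z
    show "v z * bump 3 x0 r z \<le> r * (v z * bump 2 x0 r z)"
    proof (cases "z \<in> cball x0 \<rho>")
      case True
      have "bump 3 x0 r z = max 0 (r - (norm (z - x0))\<^sup>2) * bump 2 x0 r z"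
        by (simp add: bump_def eval_nat_numeral)
      also have "\<dots> \<le> r * bump 2 x0 r z"
        using r by (intro mult_right_mono bump_nonneg) auto
      finally have "v z * bump 3 x0 r z \<le> v z * (r * bump 2 x0 r z)"
        using nn[OF True] by (intro mult_left_mono)
      then show ?thesis by (simp add: algebra_simps)
    next
      case False
      then show ?thesis using bump_eq_0[OF _ U(4) r(2) False, of 3] bump_eq_0[OF _ U(4) r(2) False, of 2] by simp
    qed
  qed (use integrable_mult_bump[OF U r(2)] in \<open>auto intro: integrable_on_mult_right\<close>)
  then have "r powr (- (real CARD('n) / 2 + 3)) * bump_integral v 3 x0 r
     \<le> r powr (- (real CARD('n) / 2 + 3)) * (r * bump_integral v 2 x0 r)"
    by (intro mult_left_mono) auto
  also have "\<dots> = bump_mean v x0 r"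
  proof -
    have "r powr (- (real CARD('n) / 2 + 2)) = r * r powr (- (real CARD('n) / 2 + 3))"
      unfolding powr_mult_base[OF less_imp_le[OF r(1)]] by (rule arg_cong[where f = "(powr) r"]) simp
    then show ?thesis unfolding bump_mean_def by simp
  qed
  finally show ?thesis .
qed

text \<open>
  The derivative of the mean is at least \<open>- M c / 12\<close>, because \<open>(r - q)\<^sub>+\<^sup>3 \<le> r (r - q)\<^sub>+\<^sup>2\<close>.
\<close>

lemma bump_mean_lower_bound:
  fixes v :: "real ^ 'n::finite \<Rightarrow> real"
  assumes v: "twice_diff_on U v v1 v2" and U: "open U" "cball x0 \<rho> \<subseteq> U" "0 \<le> \<rho>"
    and r: "0 < r" "r < \<rho>\<^sup>2"
    and lap: "\<And>z. z \<in> U \<Longrightarrow> - M \<le> (\<Sum>i\<in>UNIV. v2 i z)" and M: "0 \<le> M"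
    and c: "\<And>(x0::real ^ 'n::finite) r. 0 < r \<Longrightarrow> bump_mean (\<lambda>_. 1) x0 r = c" "c > 0"
  shows "c * v x0 \<le> bump_mean v x0 r + M * c / 12 * r"
proof (rule limit_at_right_le_of_deriv_nonneg[where G = "\<lambda>r. bump_mean v x0 r + M * c / 12 * r"])
  let ?q = "\<lambda>s. s powr (- (real CARD('n) / 2 + 3))"
  let ?G' = "\<lambda>s. ?q s / 12 * bump_integral (\<lambda>z. \<Sum>i\<in>UNIV. v2 i z) 3 x0 s + M * c / 12"
  fix s assume s: "0 < s" "s \<le> r"
  then have s\<rho>: "s < \<rho>\<^sup>2" using r by simp
  show "((\<lambda>r. bump_mean v x0 r + M * c / 12 * r) has_real_derivative ?G' s) (at s)"
    using DERIV_add[OF bump_mean_deriv[OF v U s(1) s\<rho>] DERIV_cmult[OF DERIV_ident, of "M * c / 12"]] by simp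
  have "bump_integral (\<lambda>_. - M) 3 x0 s \<le> bump_integral (\<lambda>z. \<Sum>i\<in>UNIV. v2 i z) 3 x0 s"
    by (rule bump_integral_mono[OF U(1) _ continuous_on_laplacian[OF v] U(2,3)])
      (use s\<rho> lap U in auto)
  then have "?q s * (- M * bump_integral (\<lambda>_. 1) 3 x0 s) \<le> ?q s * bump_integral (\<lambda>z. \<Sum>i\<in>UNIV. v2 i z) 3 x0 s"
    by (intro mult_left_mono) auto
  moreover have "M * (?q s * bump_integral (\<lambda>_. 1) 3 x0 s) \<le> M * c"
    using bump_integral3_le[OF open_UNIV continuous_on_const, of x0 \<rho> s 1] s s\<rho> U M c(1)[OF s(1), of x0]
    by (intro mult_left_mono) auto
  ultimately show "0 \<le> ?G' s" by (simp add: algebra_simps)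
next
  have "x0 \<in> U" using U by auto
  have "((\<lambda>r. bump_mean v x0 r + M * c / 12 * r) \<longlongrightarrow> c * v x0 + M * c / 12 * 0) (at_right 0)"
    by (intro tendsto_intros bump_mean_tendsto[OF U(1) twice_diff_onD(1)[OF v] \<open>x0 \<in> U\<close> c])
  then show "((\<lambda>r. bump_mean v x0 r + M * c / 12 * r) \<longlongrightarrow> c * v x0) (at_right 0)" by simp
qed (rule r)

section \<open>The strong maximum principle\<close>

text \<open>
  Here \<open>F' \<le> (a / 12) F\<close> for the mean \<open>F\<close> of \<open>v\<close>, and \<open>F(r) \<rightarrow> c v(x\<^sub>0) = 0\<close> as \<open>r \<rightarrow> 0\<close>. So
  \<open>F(r) exp (- a r / 12)\<close> is nonincreasing with limit \<open>0\<close>, which forces \<open>F \<le> 0\<close>; as \<open>v \<ge> 0\<close>, the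
  product of \<open>v\<close> and the weight is zero, and \<open>v\<close> vanishes wherever the weight is positive.
\<close>

lemma strong_maximum_principle_ball:
  fixes v :: "real ^ 'n::finite \<Rightarrow> real"
  assumes v: "twice_diff_on U v v1 v2" and U: "open U" "cball x0 \<rho> \<subseteq> U" "0 \<le> \<rho>"
    and nn: "\<And>z. z \<in> U \<Longrightarrow> 0 \<le> v z"
    and lap: "\<And>z. z \<in> U \<Longrightarrow> (\<Sum>i\<in>UNIV. v2 i z) \<le> a * v z" and a: "0 \<le> a"
    and "v x0 = 0" and y: "y \<in> ball x0 \<rho>"
  shows "v y = 0"
proof -
  obtain c where c: "c > 0" "\<And>(x0::real ^ 'n::finite) r. 0 < r \<Longrightarrow> bump_mean (\<lambda>_. 1) x0 r = c"
    using bump_mass by blast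
  have "(norm (y - x0))\<^sup>2 < \<rho>\<^sup>2"
    using y U by (intro power_strict_mono) (auto simp: dist_norm norm_minus_commute)
  then obtain r where r: "(norm (y - x0))\<^sup>2 < r" "r < \<rho>\<^sup>2" using dense by blast
  have r0: "0 < r" using r by (meson le_less_trans zero_le_power2)
  let ?q = "\<lambda>s. s powr (- (real CARD('n) / 2 + 3))"
  let ?I = "\<lambda>s. bump_integral (\<lambda>z. \<Sum>i\<in>UNIV. v2 i z) 3 x0 s"
  let ?G = "\<lambda>s. - (bump_mean v x0 s * exp (- (a / 12) * s))"
  have "0 \<le> ?G r"
  proof (rule limit_at_right_le_of_deriv_nonneg[where G = ?G])
    fix s assume s: "0 < s" "s \<le> r"
    then have s\<rho>: "s < \<rho>\<^sup>2" using r by simp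
    have e: "((\<lambda>s. exp (- (a / 12) * s)) has_real_derivative exp (- (a / 12) * s) * (- (a / 12))) (at s)"
      by (auto intro!: derivative_eq_intros)
    show "(?G has_real_derivative exp (- (a / 12) * s) * (a / 12 * bump_mean v x0 s - ?q s / 12 * ?I s)) (at s)"
      by (rule DERIV_cong[OF DERIV_minus[OF DERIV_mult[OF bump_mean_deriv[OF v U s(1) s\<rho>] e]]])
        (simp add: algebra_simps)
    have "?I s \<le> bump_integral (\<lambda>z. a * v z) 3 x0 s"
      by (rule bump_integral_mono[OF U(1) continuous_on_laplacian[OF v] _ U(2,3)])
        (use s\<rho> lap U in \<open>auto intro!: continuous_intros twice_diff_onD(1)[OF v]\<close>)
    also have "bump_integral (\<lambda>z. a * v z) 3 x0 s = a * bump_integral v 3 x0 s"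
      by (simp add: mult.assoc)
    finally have "?q s * ?I s \<le> ?q s * (a * bump_integral v 3 x0 s)" by (intro mult_left_mono) auto
    also have "\<dots> = a * (?q s * bump_integral v 3 x0 s)" by simp
    also have "\<dots> \<le> a * bump_mean v x0 s"
      by (intro mult_left_mono bump_integral3_le[OF U(1) twice_diff_onD(1)[OF v] U(2,3)])
        (use s s\<rho> nn U a in auto)
    finally show "0 \<le> exp (- (a / 12) * s) * (a / 12 * bump_mean v x0 s - ?q s / 12 * ?I s)" by simp
  next
    have "x0 \<in> U" using U by auto
    have "(?G \<longlongrightarrow> - (c * v x0 * exp (- (a / 12) * 0))) (at_right 0)"
      by (intro tendsto_intros bump_mean_tendsto[OF U(1) twice_diff_onD(1)[OF v] \<open>x0 \<in> U\<close> c(2,1)])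
    then show "(?G \<longlongrightarrow> 0) (at_right 0)" using \<open>v x0 = 0\<close> by simp
  qed (rule r0)
  then have "bump_mean v x0 r \<le> 0" by (simp add: mult_le_0_iff)
  then have le0: "bump_integral v 2 x0 r \<le> 0" using r0 by (simp add: bump_mean_def mult_le_0_iff)
  obtain a b where ab: "cball x0 \<rho> \<subseteq> cbox a b" by (rule cball_subset_some_cbox)
  have cont: "continuous_on UNIV (\<lambda>z. v z * bump 2 x0 r z)"
    by (rule continuous_on_mult_bump[OF U(1) twice_diff_onD(1)[OF v] U(2,3)]) (use r in auto)
  have out: "bump 2 x0 r z = 0" if "z \<notin> cball x0 \<rho>" for z
    by (rule bump_eq_0[OF _ U(3) less_imp_le[OF r(2)] that]) simp
  have nnb: "0 \<le> v z * bump 2 x0 r z" for z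
    using nn U out[of z] bump_nonneg[of 2 x0 r z] by (cases "z \<in> cball x0 \<rho>") auto
  have "integral (cbox a b) (\<lambda>z. v z * bump 2 x0 r z) = bump_integral v 2 x0 r"
  proof (rule integral_UNIV_eq_cbox[symmetric])
    fix z assume "z \<notin> cbox a b"
    then have "z \<notin> cball x0 \<rho>" using ab by blast
    from out[OF this] show "v z * bump 2 x0 r z = 0" by simp
  qed
  also have "\<dots> = 0"
    using le0 integral_nonneg[OF integrable_mult_bump[OF U(1) twice_diff_onD(1)[OF v] U(2,3)], of r 2] nnb r
    by (intro antisym) auto
  finally have "integral (cbox a b) (\<lambda>z. v z * bump 2 x0 r z) = 0" .
  moreover have "\<rho> > 0" using y by (metis dist_not_less_zero mem_ball not_less_iff_gr_or_eq order.strict_trans1 zero_le_dist)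
  then have "ball x0 \<rho> \<noteq> {}" by simp
  then have "interior (cbox a b) \<noteq> {}"
    using interior_mono[OF ab] by (auto simp: interior_cball)
  then have "box a b \<noteq> {}" by (simp add: interior_cbox)
  ultimately have "\<forall>z\<in>cbox a b. v z * bump 2 x0 r z = 0"
    by (subst (asm) integral_cbox_eq_0_iff) (auto intro: continuous_on_subset[OF cont] nnb)
  moreover have "y \<in> cbox a b" using y ab by auto
  moreover have "bump 2 x0 r y \<noteq> 0" using r by (simp add: bump_def)
  ultimately show ?thesis by auto
qed

text \<open>
  The zero set is relatively closed by continuity and relatively open by the previous lemma.
\<close>

lemma strong_maximum_principle:
  fixes v :: "real ^ 'n::finite \<Rightarrow> real"
  assumes v: "twice_diff_on U v v1 v2" and U: "open U"
    and nn: "\<And>z. z \<in> U \<Longrightarrow> 0 \<le> v z"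
    and lap: "\<And>z. z \<in> U \<Longrightarrow> (\<Sum>i\<in>UNIV. v2 i z) \<le> a * v z" and a: "0 \<le> a"
    and S: "connected S" "S \<subseteq> U"
    and x: "x \<in> S" "v x = 0" and y: "y \<in> S"
  shows "v y = 0"
proof -
  define T where "T = {z \<in> S. v z = 0}"
  have "openin (top_of_set S) T"
    unfolding openin_euclidean_subtopology_iff
  proof (intro conjI ballI)
    show "T \<subseteq> S" by (auto simp: T_def)
    fix z assume z: "z \<in> T"
    then obtain \<rho> where \<rho>: "0 < \<rho>" "cball z \<rho> \<subseteq> U"
      using S U open_contains_cball unfolding T_def by blast
    have "v z' = 0" if "z' \<in> ball z \<rho>" for z'
      by (rule strong_maximum_principle_ball[OF v U \<rho>(2) less_imp_le[OF \<rho>(1)] nn lap a _ that])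
        (use z in \<open>auto simp: T_def\<close>)
    then show "\<exists>e>0. \<forall>z'\<in>S. dist z' z < e \<longrightarrow> z' \<in> T"
      using \<rho> by (intro exI[of _ \<rho>]) (auto simp: T_def dist_commute)
  qed
  moreover have "closedin (top_of_set S) T"
    unfolding T_def
    by (rule continuous_closedin_preimage_constant[OF continuous_on_subset[OF twice_diff_onD(1)[OF v] S(2)]])
  ultimately have "T = {} \<or> T = S" using S(1) unfolding connected_clopen by blast
  then show ?thesis using x y by (auto simp: T_def)
qed

section \<open>The maximum principle for systems and small sets\<close>

text \<open>
  Unlike the fundamental solution, the logarithm has the same form in every dimension. It is
  superharmonic for \<open>n \<ge> 2\<close> and tends to \<open>\<infinity>\<close> at \<open>a\<close>, which is all that is needed to remove a point.
\<close>

lemma twice_diff_on_log_barrier: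
  fixes a :: "real ^ 'n::finite"
  shows "twice_diff_on (- {a}) (\<lambda>x. D - ln ((norm (x - a))\<^sup>2))
     (\<lambda>i x. - (2 * (x - a) $ i / (norm (x - a))\<^sup>2))
     (\<lambda>i x. - (2 / (norm (x - a))\<^sup>2) + 4 * ((x - a) $ i)\<^sup>2 / ((norm (x - a))\<^sup>2)\<^sup>2)"
  unfolding twice_diff_on_def
proof (intro conjI allI ballI)
  fix i and x :: "real ^ 'n" assume x: "x \<in> - {a}"
  let ?q = "\<lambda>t. (norm (x + t *\<^sub>R axis i 1 - a))\<^sup>2"
  let ?y = "\<lambda>t. (x + t *\<^sub>R axis i 1 - a) $ i"
  have q0: "?q 0 > 0" using x by simp
  have eq: "?q t = (norm (x - a))\<^sup>2 + 2 * t * (x - a) $ i + t\<^sup>2" for t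
    using norm_power2_axis_shift[of "x - a" t i] by (simp add: algebra_simps)
  have dq: "(?q has_real_derivative 2 * (x - a) $ i) (at 0)"
    unfolding eq by (auto intro!: derivative_eq_intros)
  have dy: "(?y has_real_derivative 1) (at 0)"
    by (auto intro!: derivative_eq_intros)
  have "((\<lambda>t. ln (?q t)) has_real_derivative 1 / ?q 0 * (2 * (x - a) $ i)) (at 0)"
    by (rule DERIV_chain2[OF DERIV_ln_divide[OF q0] dq])
  from DERIV_diff[OF DERIV_const[of D] this]
  show "((\<lambda>t. D - ln (?q t)) has_real_derivative - (2 * (x - a) $ i / (norm (x - a))\<^sup>2)) (at 0)"
    by (rule DERIV_cong) simp
  have "?q 0 \<noteq> 0" using q0 by simp
  from DERIV_minus[OF DERIV_divide[OF DERIV_cmult[OF dy, of 2] dq this]]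
  show "((\<lambda>t. - (2 * ?y t / ?q t)) has_real_derivative
     - (2 / (norm (x - a))\<^sup>2) + 4 * ((x - a) $ i)\<^sup>2 / ((norm (x - a))\<^sup>2)\<^sup>2) (at 0)"
    by (rule DERIV_cong) (use x in \<open>simp add: field_simps power2_eq_square\<close>)
qed (auto intro!: continuous_intros)

lemma log_barrier_superharmonic:
  fixes a x :: "real ^ 'n::finite"
  assumes "CARD('n) \<ge> 2"
  shows "(\<Sum>i\<in>UNIV. - (2 / (norm (x - a))\<^sup>2) + 4 * ((x - a) $ i)\<^sup>2 / ((norm (x - a))\<^sup>2)\<^sup>2) \<le> 0"
proof -
  let ?q = "(norm (x - a))\<^sup>2"
  have sq: "(\<Sum>i\<in>UNIV. ((x - a) $ i)\<^sup>2) = ?q"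
    unfolding norm_vec_def L2_set_def by (subst real_sqrt_pow2) (auto intro: sum_nonneg)
  have "(\<Sum>i\<in>UNIV. - (2 / ?q) + 4 * ((x - a) $ i)\<^sup>2 / ?q\<^sup>2) =
     (\<Sum>i\<in>(UNIV::'n set). - (2 / ?q)) + 4 * (\<Sum>i\<in>UNIV. ((x - a) $ i)\<^sup>2) / ?q\<^sup>2"
    by (simp only: sum.distrib sum_distrib_left sum_divide_distrib)
  also have "\<dots> = - (2 * (real CARD('n) - 2) / ?q)"
    unfolding sq by (cases "?q = 0") (simp_all add: power2_eq_square[of ?q] field_simps)
  also have "\<dots> \<le> 0" using assms by simp
  finally show ?thesis .
qed

lemma open_if_eventually_nhds:
  assumes "\<And>b. b \<in> S \<Longrightarrow> \<forall>\<^sub>F x in nhds b. x \<in> S"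
  shows "open S"
proof (subst open_subopen, intro ballI)
  fix b assume "b \<in> S"
  from assms[OF this] obtain T where "open T" "b \<in> T" "\<forall>x\<in>T. x \<in> S"
    unfolding eventually_nhds by blast
  then show "\<exists>T. open T \<and> b \<in> T \<and> T \<subseteq> S" by blast
qed

text \<open>
  The function \<open>v = (- (w + \<epsilon> \<psi>) - \<epsilon>)\<^sub>+\<^sup>3\<close>, where \<open>\<psi> \<ge> 0\<close> is the logarithmic barrier at \<open>a\<close>, has compact
  support in \<open>V\<close>: near \<open>a\<close> the barrier dominates the lower bound of \<open>w\<close>, near the rest of the boundary
  \<open>w > - \<epsilon>\<close>. Moreover \<open>v \<le> \<mu>\<^sup>3\<close>, \<open>v\<close> vanishes off \<open>S\<close>, and \<open>\<Delta>v \<ge> - 3 C \<mu>\<^sup>3\<close>. The mean of \<open>v\<close> over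
  the ball of radius \<open>\<surd>R\<close> is at most \<open>\<mu>\<^sup>3 R\<^bsup>-n/2\<^esup> |S| \<le> c \<mu>\<^sup>3 / 16\<close> by the smallness of \<open>S\<close>, and the error
  term is \<open>3 C \<mu>\<^sup>3 c R / 12 \<le> c \<mu>\<^sup>3 / 16\<close>. Hence \<open>v \<le> (\<mu>/2)\<^sup>3\<close>, and \<open>\<epsilon> \<rightarrow> 0\<close> gives the claim.
\<close>

lemma negative_part_halving:
  fixes w :: "real ^ 'n::finite \<Rightarrow> real"
  assumes n: "CARD('n) \<ge> 2" and V: "open V" "bounded V" "a \<notin> V"
    and w: "twice_diff_on V w w1 w2"
    and below: "\<And>x. x \<in> V \<Longrightarrow> - \<mu> \<le> w x" and \<mu>: "0 \<le> \<mu>"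
    and bdry: "\<And>b e. b \<in> frontier V \<Longrightarrow> b \<noteq> a \<Longrightarrow> 0 < e \<Longrightarrow> \<forall>\<^sub>F x in at b within V. - e < w x"
    and lap: "\<And>x. x \<in> V \<Longrightarrow> w x < 0 \<Longrightarrow> (\<Sum>i\<in>UNIV. w2 i x) \<le> C * \<mu>" and C: "0 \<le> C"
    and S: "{x \<in> V. w x < 0} \<subseteq> S" "S \<in> lmeasurable"
    and R: "0 < R" "C * R \<le> 1 / 4"
    and c: "\<And>(x0::real ^ 'n::finite) r. 0 < r \<Longrightarrow> bump_mean (\<lambda>_. 1) x0 r = c" "c > 0"
    and small: "measure lebesgue S \<le> c / 16 * R powr (real CARD('n) / 2)"
    and x0: "x0 \<in> V"
  shows "- (\<mu> / 2) \<le> w x0"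
proof -
  obtain \<rho> where \<rho>: "V \<subseteq> cball a \<rho>" 
    using bounded_subset_ballD[OF V(2), of a] ball_subset_cball by (metis order_trans)
  define D where "D = ln (\<rho>\<^sup>2)"
  define \<psi> where "\<psi> x = D - ln ((norm (x - a))\<^sup>2)" for x
  define \<psi>2 where "\<psi>2 i x = - (2 / (norm (x - a))\<^sup>2) + 4 * ((x - a) $ i)\<^sup>2 / ((norm (x - a))\<^sup>2)\<^sup>2" for i x
  have \<psi>_nonneg: "0 \<le> \<psi> x" if "x \<in> V" for x
  proof -
    have "0 < norm (x - a)" using that V(3) by auto
    moreover have "norm (x - a) \<le> \<rho>" using \<rho> that by (auto simp: dist_norm norm_minus_commute)
    ultimately have "0 < (norm (x - a))\<^sup>2" "(norm (x - a))\<^sup>2 \<le> \<rho>\<^sup>2" by (auto intro: power_mono)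
    then have "ln ((norm (x - a))\<^sup>2) \<le> ln (\<rho>\<^sup>2)" by (subst ln_le_cancel_iff) auto
    then show ?thesis by (simp add: \<psi>_def D_def)
  qed
  obtain \<psi>1 where \<psi>: "twice_diff_on V \<psi> \<psi>1 \<psi>2"
    using twice_diff_on_subset[OF twice_diff_on_log_barrier[of a D], of V] V(3)
    unfolding \<psi>_def[abs_def] \<psi>2_def[abs_def] by blast
  have step: "- (w x0 + \<epsilon> * \<psi> x0) - \<epsilon> \<le> \<mu> / 2" if \<epsilon>: "0 < \<epsilon>" for \<epsilon>
  proof -
    define z where "z x = (- 1) * (w x + \<epsilon> * \<psi> x) + - \<epsilon>" for x
    define z1 where "z1 i x = (- 1) * (w1 i x + \<epsilon> * \<psi>1 i x) + 0" for i x
    define z2 where "z2 i x = (- 1) * (w2 i x + \<epsilon> * \<psi>2 i x) + 0" for i x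
    have z: "twice_diff_on V z z1 z2"
      unfolding z_def[abs_def] z1_def[abs_def] z2_def[abs_def]
      by (intro twice_diff_on_add twice_diff_on_cmult twice_diff_on_const w \<psi>)
    have z_pos: "w x < 0 \<and> z x \<le> \<mu>" if "x \<in> V" "0 \<le> z x" for x
    proof -
      have "0 \<le> \<epsilon> * \<psi> x" using \<psi>_nonneg[OF that(1)] \<epsilon> by simp
      then show ?thesis using that(2) below[OF that(1)] \<epsilon> by (auto simp: z_def)
    qed
    define K where "K = {x \<in> V. 0 \<le> z x}"
    have near: "\<forall>\<^sub>F x in nhds b. x \<notin> K" if b: "b \<notin> K" for b
    proof (cases "b \<in> V")
      case True
      then have "z b < 0" using b by (simp add: K_def)
      moreover have "isCont z b"
        using twice_diff_onD(1)[OF z] V(1) True continuous_on_eq_continuous_at by blast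
      then have "(z \<longlongrightarrow> z b) (nhds b)" unfolding isCont_def tendsto_at_iff_tendsto_nhds .
      ultimately have "\<forall>\<^sub>F x in nhds b. z x < 0" by (auto dest: order_tendstoD(2))
      then show ?thesis by eventually_elim (simp add: K_def)
    next
      case b_out: False
      show ?thesis
      proof (cases "b \<in> frontier V")
        case False
        then have "b \<in> - closure V" using b_out closure_Un_frontier[of V] by auto
        then have "\<forall>\<^sub>F x in nhds b. x \<in> - closure V" by (intro eventually_nhds_in_open) auto
        then show ?thesis by eventually_elim (use closure_subset in \<open>auto simp: K_def\<close>)
      next
        case front: True
        show ?thesis
        proof (cases "b = a")
          case False
          from bdry[OF front this \<epsilon>] have "\<forall>\<^sub>F x in nhds b. x \<noteq> b \<longrightarrow> x \<in> V \<longrightarrow> - \<epsilon> < w x"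
            by (simp add: eventually_at_filter)
          then show ?thesis
          proof eventually_elim
            case (elim x)
            show ?case
            proof
              assume "x \<in> K"
              then have x: "x \<in> V" "0 \<le> z x" by (auto simp: K_def)
              then have "- \<epsilon> < w x" using elim b_out by auto
              moreover have "0 \<le> \<epsilon> * \<psi> x" using \<psi>_nonneg[OF x(1)] \<epsilon> by simp
              ultimately show False using x(2) by (simp add: z_def)
            qed
          qed
        next
          case True
          \<comment> \<open>The radius at which the barrier reaches the value \<open>\<mu> / \<epsilon>\<close>.\<close>
          define s where "s = sqrt (exp (D - \<mu> / \<epsilon>))"
          have "0 < s" by (simp add: s_def)
          then have "\<forall>\<^sub>F x in nhds b. x \<in> ball b s" by (intro eventually_nhds_in_open) auto
          then show ?thesis
          proof eventually_elim
            case (elim x)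
            show ?case
            proof
              assume "x \<in> K"
              then have x: "x \<in> V" "0 \<le> z x" by (auto simp: K_def)
              then have "0 < norm (x - a)" using V(3) by auto
              moreover have "norm (x - a) < s" using elim True by (auto simp: dist_norm norm_minus_commute)
              ultimately have "0 < (norm (x - a))\<^sup>2" "(norm (x - a))\<^sup>2 < s\<^sup>2"
                by (auto intro!: power_strict_mono)
              moreover have "s\<^sup>2 = exp (D - \<mu> / \<epsilon>)" by (simp add: s_def)
              ultimately have "ln ((norm (x - a))\<^sup>2) < D - \<mu> / \<epsilon>"
                by (metis exp_less_cancel_iff exp_ln)
              then have "\<mu> / \<epsilon> < \<psi> x" by (simp add: \<psi>_def)
              then have "\<mu> < \<epsilon> * \<psi> x" using \<epsilon> by (simp add: field_simps)
              then show False using x below[OF x(1)] \<epsilon> by (simp add: z_def)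
            qed
          qed
        qed
      qed
    qed
    have K: "closed K" "K \<subseteq> V"
    proof -
      have "open (- K)" by (rule open_if_eventually_nhds) (use near in simp)
      then show "closed K" by (simp add: closed_def)
    qed (auto simp: K_def)
    define v where "v x = (if x \<in> V then (max 0 (z x)) ^ 3 else 0)" for x
    define v1 where "v1 i x = (if x \<in> V then 3 * (max 0 (z x))\<^sup>2 * z1 i x else 0)" for i x
    define v2 where "v2 i x = (if x \<in> V then 6 * max 0 (z x) * (z1 i x)\<^sup>2 + 3 * (max 0 (z x))\<^sup>2 * z2 i x else 0)" for i x
    have v: "twice_diff_on UNIV v v1 v2"
      unfolding v_def[abs_def] v1_def[abs_def] v2_def[abs_def]
      by (rule twice_diff_on_extend_zero[OF twice_diff_on_cube_pos_part[OF z] V(1) K])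
        (auto simp: K_def max_def)
    have lap_v: "- (3 * C * \<mu> ^ 3) \<le> (\<Sum>i\<in>UNIV. v2 i x)" for x
    proof (cases "x \<in> V \<and> 0 \<le> z x")
      case True
      then have x: "x \<in> V" "0 \<le> z x" by auto
      have "(\<Sum>i\<in>UNIV. \<psi>2 i x) \<le> 0" unfolding \<psi>2_def by (rule log_barrier_superharmonic[OF n])
      then have "\<epsilon> * (\<Sum>i\<in>UNIV. \<psi>2 i x) \<le> 0" using \<epsilon> by (simp add: mult_le_0_iff)
      moreover have "(\<Sum>i\<in>UNIV. z2 i x) = - (\<Sum>i\<in>UNIV. w2 i x) - \<epsilon> * (\<Sum>i\<in>UNIV. \<psi>2 i x)"
        by (simp add: z2_def sum.distrib sum_subtractf sum_negf sum_distrib_left)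
      ultimately have "- (C * \<mu>) \<le> (\<Sum>i\<in>UNIV. z2 i x)"
        using lap[OF x(1)] z_pos[OF x] by linarith
      then have "3 * (z x)\<^sup>2 * - (C * \<mu>) \<le> 3 * (z x)\<^sup>2 * (\<Sum>i\<in>UNIV. z2 i x)"
        by (rule mult_left_mono) simp
      also have "\<dots> = (\<Sum>i\<in>UNIV. 3 * (z x)\<^sup>2 * z2 i x)" by (rule sum_distrib_left)
      also have "\<dots> \<le> (\<Sum>i\<in>UNIV. v2 i x)" using x by (intro sum_mono) (simp add: v2_def)
      finally have "- (3 * ((z x)\<^sup>2 * (C * \<mu>))) \<le> (\<Sum>i\<in>UNIV. v2 i x)" by simp
      moreover have "(z x)\<^sup>2 * (C * \<mu>) \<le> \<mu>\<^sup>2 * (C * \<mu>)"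
        using z_pos[OF x] x \<mu> C by (intro mult_right_mono power_mono) auto
      moreover have "\<mu>\<^sup>2 * (C * \<mu>) = C * \<mu> ^ 3" by (simp add: eval_nat_numeral)
      ultimately show ?thesis by linarith
    next
      case False
      then have "v2 i x = 0" for i by (auto simp: v2_def max_def)
      then have "(\<Sum>i\<in>UNIV. v2 i x) = 0" by simp
      then show ?thesis using C \<mu> by simp
    qed
    have v_le: "v x \<le> \<mu> ^ 3 * indicator S x" and v_nonneg: "0 \<le> v x" for x
    proof -
      show "0 \<le> v x" by (simp add: v_def)
      show "v x \<le> \<mu> ^ 3 * indicator S x"
      proof (cases "x \<in> V \<and> 0 \<le> z x")
        case True
        then have "x \<in> S" using z_pos[of x] S by auto
        moreover have "(z x) ^ 3 \<le> \<mu> ^ 3" using True z_pos[of x] by (intro power_mono) auto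
        ultimately show ?thesis using True by (simp add: v_def)
      next
        case False
        then have "v x = 0" by (auto simp: v_def max_def)
        then show ?thesis using \<mu> by simp
      qed
    qed
    \<comment> \<open>Any radius beyond the support of the bump will do, as \<open>v\<close> lives on the whole space.\<close>
    define \<rho>' where "\<rho>' = sqrt R + 1"
    have \<rho>': "0 \<le> \<rho>'" "R < \<rho>'\<^sup>2" using R by (auto simp: \<rho>'_def power2_eq_square algebra_simps add_pos_nonneg)
    have int: "(\<lambda>x. v x * bump 2 x0 R x) integrable_on UNIV"
      by (rule integrable_mult_bump[OF open_UNIV twice_diff_onD(1)[OF v] _ \<rho>'(1) less_imp_le[OF \<rho>'(2)]]) auto
    have hS: "((\<lambda>x. \<mu> ^ 3 * R\<^sup>2 * indicator S x) has_integral \<mu> ^ 3 * R\<^sup>2 * measure lebesgue S) UNIV"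
      by (rule has_integral_mult_right) (use S(2) in \<open>simp add: lmeasurable_iff_has_integral\<close>)
    have "bump_integral v 2 x0 R \<le> \<mu> ^ 3 * R\<^sup>2 * measure lebesgue S"
    proof (rule has_integral_le[OF integrable_integral[OF int] hS])
      fix x
      have "bump 2 x0 R x \<le> R\<^sup>2" unfolding bump_def using R by (intro power_mono) auto
      then have "v x * bump 2 x0 R x \<le> (\<mu> ^ 3 * indicator S x) * R\<^sup>2"
        using v_le[of x] v_nonneg[of x] \<mu> by (intro mult_mono) (auto simp: bump_nonneg)
      then show "v x * bump 2 x0 R x \<le> \<mu> ^ 3 * R\<^sup>2 * indicator S x" by (simp add: algebra_simps)
    qed
    then have "bump_mean v x0 R \<le> R powr (- (real CARD('n) / 2 + 2)) * (\<mu> ^ 3 * R\<^sup>2 * measure lebesgue S)"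
      unfolding bump_mean_def by (intro mult_left_mono) auto
    also have "\<dots> \<le> R powr (- (real CARD('n) / 2 + 2)) * (\<mu> ^ 3 * R\<^sup>2 * (c / 16 * R powr (real CARD('n) / 2)))"
      using small \<mu> by (intro mult_left_mono) auto
    also have "\<dots> = \<mu> ^ 3 * c / 16 * (R powr (- (real CARD('n) / 2 + 2)) * (R powr 2 * R powr (real CARD('n) / 2)))"
      using R by (simp add: powr_numeral)
    also have "R powr (- (real CARD('n) / 2 + 2)) * (R powr 2 * R powr (real CARD('n) / 2)) = 1"
      unfolding powr_add[symmetric] using R by simp
    finally have mean: "bump_mean v x0 R \<le> \<mu> ^ 3 * c / 16" by simp
    have "c * v x0 \<le> bump_mean v x0 R + 3 * C * \<mu> ^ 3 * c / 12 * R"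
      by (rule bump_mean_lower_bound[OF v open_UNIV _ \<rho>'(1) R(1) \<rho>'(2) lap_v _ c]) (use C \<mu> in auto)
    also have "3 * C * \<mu> ^ 3 * c / 12 * R = (C * R) * (\<mu> ^ 3 * c) / 4" by simp
    also have "\<dots> \<le> 1 / 4 * (\<mu> ^ 3 * c) / 4"
      using R(2) \<mu> c(2) by (intro divide_right_mono mult_right_mono) auto
    finally have "c * v x0 \<le> c * (\<mu> ^ 3 / 8)" using mean by (simp add: algebra_simps)
    then have "v x0 \<le> (\<mu> / 2) ^ 3" using c(2) by (simp add: power_divide)
    then have "(max 0 (z x0)) ^ 3 \<le> (\<mu> / 2) ^ 3" using x0 by (simp add: v_def)
    then have "max 0 (z x0) \<le> \<mu> / 2" using \<mu> power_mono_iff[of "max 0 (z x0)" "\<mu> / 2" 3] by simp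
    then have "z x0 \<le> \<mu> / 2" by simp
    then show ?thesis unfolding z_def by (simp only: mult_minus1 diff_conv_add_uminus)
  qed
  show ?thesis
  proof (rule field_le_epsilon)
    fix e :: real assume e: "0 < e"
    have p: "0 < 1 + \<psi> x0" using \<psi>_nonneg[OF x0] by simp
    then obtain t where t: "0 < t" "t * (1 + \<psi> x0) = e"
      using e by (metis divide_pos_pos nonzero_eq_divide_eq less_irrefl)
    then have "t * \<psi> x0 + t = e" by (simp add: distrib_left)
    then show "- (\<mu> / 2) \<le> w x0 + e" using step[OF t(1)] by simp
  qed
qed

text \<open>
  The bound \<open>\<mu>\<close> in the differential inequality is a common lower bound of all components, so the
  coupling of the system is harmless: all components can be halved simultaneously.
  For \<open>C = 0\<close> the number \<open>R\<close> can be arbitrarily large, and the lemma is the weak maximum principle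
  on an arbitrary bounded open set; for \<open>C > 0\<close> it is a maximum principle for small sets.
\<close>

lemma maximum_principle_system:
  fixes w :: "'j \<Rightarrow> real ^ 'n::finite \<Rightarrow> real"
  assumes n: "CARD('n) \<ge> 2" and V: "open V" "bounded V" "a \<notin> V"
    and w: "\<And>j. j \<in> J \<Longrightarrow> twice_diff_on V (w j) (w1 j) (w2 j)"
    and below: "\<And>j x. j \<in> J \<Longrightarrow> x \<in> V \<Longrightarrow> - B \<le> w j x"
    and bdry: "\<And>j b e. j \<in> J \<Longrightarrow> b \<in> frontier V \<Longrightarrow> b \<noteq> a \<Longrightarrow> 0 < e \<Longrightarrow>
        \<forall>\<^sub>F x in at b within V. - e < w j x"
    and lap: "\<And>\<mu> j x. 0 \<le> \<mu> \<Longrightarrow> (\<And>k y. k \<in> J \<Longrightarrow> y \<in> V \<Longrightarrow> - \<mu> \<le> w k y) \<Longrightarrow>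
        j \<in> J \<Longrightarrow> x \<in> V \<Longrightarrow> w j x < 0 \<Longrightarrow> (\<Sum>i\<in>UNIV. w2 j i x) \<le> C * \<mu>"
    and C: "0 \<le> C"
    and S: "\<And>j. j \<in> J \<Longrightarrow> {x \<in> V. w j x < 0} \<subseteq> S" "S \<in> lmeasurable"
    and R: "0 < R" "C * R \<le> 1 / 4"
    and c: "\<And>(x0::real ^ 'n::finite) r. 0 < r \<Longrightarrow> bump_mean (\<lambda>_. 1) x0 r = c" "c > 0"
    and small: "measure lebesgue S \<le> c / 16 * R powr (real CARD('n) / 2)"
    and jx: "j \<in> J" "x \<in> V"
  shows "0 \<le> w j x"
proof -
  define b where "b k = \<bar>B\<bar> / 2 ^ k" for k :: nat
  have bound: "- b k \<le> w j x" if "j \<in> J" "x \<in> V" for k j x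
    using that
  proof (induction k arbitrary: j x)
    case 0
    then show ?case using below[of j x] by (simp add: b_def)
  next
    case (Suc k)
    have "0 \<le> b k" by (simp add: b_def)
    have "- (b k / 2) \<le> w j x"
      by (rule negative_part_halving[OF n V w[OF Suc.prems(1)] Suc.IH[OF Suc.prems(1)] \<open>0 \<le> b k\<close>
            bdry[OF Suc.prems(1)] lap[OF \<open>0 \<le> b k\<close> Suc.IH Suc.prems(1)] C S(1)[OF Suc.prems(1)]
            S(2) R c small Suc.prems(2)])
    then show ?case by (simp add: b_def mult.commute)
  qed
  have "(\<lambda>k. - b k) \<longlonglongrightarrow> - (\<bar>B\<bar> * 0)"
    unfolding b_def divide_inverse power_inverse[symmetric]
    by (intro tendsto_intros LIMSEQ_realpow_zero) auto
  then show ?thesis using bound[OF jx] by (intro LIMSEQ_le_const2[of "\<lambda>k. - b k"]) auto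
qed

section \<open>Reflections\<close>

definition reflect_at :: "'n::finite \<Rightarrow> real \<Rightarrow> real ^ 'n \<Rightarrow> real ^ 'n" where
  "reflect_at k l x = x + (2 * (l - x $ k)) *\<^sub>R axis k 1"

lemma reflect_at_nth: "reflect_at k l x $ j = (if j = k then 2 * l - x $ k else x $ j)"
  by (auto simp: reflect_at_def axis_def)

lemma reflect_at_involutive [simp]: "reflect_at k l (reflect_at k l x) = x"
  by (simp add: vec_eq_iff reflect_at_nth)

lemma reflect_eq_reflect_at: "reflect k x = reflect_at k 0 x"
  by (simp add: vec_eq_iff reflect_at_nth reflect_def)

text \<open>
  This reduces differentiating along an axis after reflecting to a sign change of the parameter.
\<close>

lemma reflect_at_axis_shift:
  "reflect_at k l (x + t *\<^sub>R axis i 1) = reflect_at k l x + ((if i = k then - 1 else 1) * t) *\<^sub>R axis i 1"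
  by (auto simp: vec_eq_iff reflect_at_nth axis_def)

lemma continuous_on_reflect_at [continuous_intros]:
  fixes g :: "'a::topological_space \<Rightarrow> real ^ 'n::finite"
  assumes "continuous_on A g" "continuous_on A l"
  shows "continuous_on A (\<lambda>x. reflect_at k (l x) (g x))"
  unfolding reflect_at_def by (intro continuous_intros assms)

lemma twice_diff_on_reflect_at:
  assumes v: "twice_diff_on U v v1 v2" and V: "\<And>x. x \<in> V \<Longrightarrow> reflect_at k l x \<in> U"
  shows "twice_diff_on V (\<lambda>x. v (reflect_at k l x))
     (\<lambda>i x. (if i = k then - 1 else 1) * v1 i (reflect_at k l x)) (\<lambda>i x. v2 i (reflect_at k l x))"
  unfolding twice_diff_on_def
proof (intro conjI allI ballI)
  note vD = twice_diff_onD[OF v]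
  have c: "continuous_on V (reflect_at k l)" by (intro continuous_intros)
  have im: "reflect_at k l ` V \<subseteq> U" using V by auto
  show "continuous_on V (\<lambda>x. v (reflect_at k l x))" by (rule continuous_on_compose2[OF vD(1) c im])
  fix i
  show "continuous_on V (\<lambda>x. (if i = k then - 1 else 1) * v1 i (reflect_at k l x))"
    by (intro continuous_on_mult_left continuous_on_compose2[OF vD(2) c im])
  show "continuous_on V (\<lambda>x. v2 i (reflect_at k l x))" by (rule continuous_on_compose2[OF vD(3) c im])
  fix x assume x: "x \<in> V"
  define \<sigma> where "\<sigma> = (if i = k then - 1 else 1 :: real)"
  have lin: "((\<lambda>t. \<sigma> * t) has_real_derivative \<sigma>) (at 0)" by (auto intro!: derivative_eq_intros)
  have chain: "((\<lambda>t. g (reflect_at k l (x + t *\<^sub>R axis i 1))) has_real_derivative D * \<sigma>) (at 0)"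
    if "((\<lambda>t. g (reflect_at k l x + t *\<^sub>R axis i 1)) has_real_derivative D) (at 0)" for g :: "real ^ 'a \<Rightarrow> real" and D
    using DERIV_chain2[of "\<lambda>t. g (reflect_at k l x + t *\<^sub>R axis i 1)" D "\<lambda>t. \<sigma> * t" 0 \<sigma> UNIV] that lin
    unfolding reflect_at_axis_shift \<sigma>_def[symmetric] by simp
  have sg: "\<sigma> * (D * \<sigma>) = D" for D by (simp add: \<sigma>_def)
  show "((\<lambda>t. v (reflect_at k l (x + t *\<^sub>R axis i 1))) has_real_derivative
      (if i = k then - 1 else 1) * v1 i (reflect_at k l x)) (at 0)"
    using chain[OF vD(4)[OF V[OF x]]] unfolding \<sigma>_def[symmetric] by (simp add: mult.commute)
  show "((\<lambda>t. (if i = k then - 1 else 1) * v1 i (reflect_at k l (x + t *\<^sub>R axis i 1))) has_real_derivative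
      v2 i (reflect_at k l x)) (at 0)"
    using DERIV_cmult[OF chain[OF vD(5)[OF V[OF x]]], of \<sigma>]
    unfolding \<sigma>_def[symmetric] sg .
qed

lemma eventually_nhds_tube:
  assumes "compact K" "open W" "\<And>x. x \<in> K \<Longrightarrow> (l0, x) \<in> W"
  shows "\<forall>\<^sub>F l in nhds l0. \<forall>x\<in>K. (l, x) \<in> W"
proof -
  have "{l0} \<times> K \<subseteq> W" using assms(3) by auto
  from Elementary_Topology.tube_lemma[OF assms(1,2) this] obtain X where "l0 \<in> X" "open X" "X \<times> K \<subseteq> W" by blast
  then show ?thesis unfolding eventually_nhds by blast
qed

section \<open>The second-order system: signs\<close>

text \<open>
  The unknowns \<open>u 0, \<dots>, u (m - 1)\<close> with \<open>- \<Delta> u\<^sub>j + \<alpha>\<^sub>j u\<^sub>j = u\<^sub>j\<^sub>+\<^sub>1\<close>, where \<open>f (u 0)\<close> stands for \<open>u\<^sub>m\<close>. These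
  assumptions are stable under the reflection \<open>x\<^sub>k \<mapsto> - x\<^sub>k\<close>, which is used for the symmetry.
\<close>

locale moving_plane_system =
  fixes \<Omega> :: "(real ^ 'n::finite) set" and k :: 'n and m :: nat and \<alpha> :: "nat \<Rightarrow> real"
    and f :: "real \<Rightarrow> real" and L B :: real
    and u :: "nat \<Rightarrow> real ^ 'n \<Rightarrow> real" and u1 u2 :: "nat \<Rightarrow> 'n \<Rightarrow> real ^ 'n \<Rightarrow> real"
  assumes dim: "CARD('n) \<ge> 2"
    and open_\<Omega>: "open \<Omega>" and bounded_\<Omega>: "bounded \<Omega>" and connected_\<Omega>: "connected \<Omega>"
    and convex_\<Omega>: "convex_in_direction k \<Omega>" and symmetric_\<Omega>: "symmetric_in k \<Omega>"
    and m_pos: "0 < m" and \<alpha>_nonneg: "\<And>j. j < m \<Longrightarrow> 0 \<le> \<alpha> j"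
    and L_nonneg: "0 \<le> L" and f_lipschitz: "\<And>s t. 0 \<le> s \<Longrightarrow> s \<le> t \<Longrightarrow> f t - f s \<le> L * (t - s)"
    and f_mono: "\<And>s t. 0 \<le> s \<Longrightarrow> s \<le> t \<Longrightarrow> f s \<le> f t" and f_nonneg: "0 \<le> f 0"
    and twice_diff_u: "\<And>j. j < m \<Longrightarrow> twice_diff_on (\<Omega> - {0}) (u j) (u1 j) (u2 j)"
    and laplacian_u: "\<And>j x. j < m \<Longrightarrow> x \<in> \<Omega> - {0} \<Longrightarrow>
        (\<Sum>i\<in>UNIV. u2 j i x) = \<alpha> j * u j x - (if Suc j < m then u (Suc j) x else f (u 0 x))"
    and u0_pos: "\<And>x. x \<in> \<Omega> - {0} \<Longrightarrow> 0 < u 0 x"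
    and u_below: "\<And>j x. j < m \<Longrightarrow> x \<in> \<Omega> - {0} \<Longrightarrow> - B \<le> u j x"
    and u_boundary: "\<And>j b. j < m \<Longrightarrow> b \<in> frontier \<Omega> \<Longrightarrow> (u j \<longlongrightarrow> 0) (at b within \<Omega> - {0})"
begin

lemma open_punctured: "open (\<Omega> - {0})"
  using open_\<Omega> by auto

lemma frontier_\<Omega>I: "b \<in> closure V \<Longrightarrow> V \<subseteq> \<Omega> \<Longrightarrow> b \<notin> \<Omega> \<Longrightarrow> b \<in> frontier \<Omega>"
  using closure_mono[of V \<Omega>] open_\<Omega> by (auto simp: frontier_def interior_open)

lemma isCont_u:
  assumes "j < m" "x \<in> \<Omega> - {0}"
  shows "isCont (u j) x"
  using twice_diff_onD(1)[OF twice_diff_u[OF assms(1)]] open_punctured assms(2)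
    continuous_on_eq_continuous_at by blast

lemma eventually_abs_u_less:
  assumes "j < m" "b \<in> frontier \<Omega>" "0 < e"
  shows "\<forall>\<^sub>F x in nhds b. x \<in> \<Omega> - {0} \<longrightarrow> \<bar>u j x\<bar> < e"
proof -
  have "b \<notin> \<Omega>" using assms(2) open_\<Omega> by (auto simp: frontier_def interior_open)
  have "\<forall>\<^sub>F x in nhds b. x \<noteq> b \<longrightarrow> x \<in> \<Omega> - {0} \<longrightarrow> dist (u j x) 0 < e"
    using tendstoD[OF u_boundary[OF assms(1,2)] assms(3)] by (simp add: eventually_at_filter)
  then show ?thesis by eventually_elim (use \<open>b \<notin> \<Omega>\<close> in auto)
qed

text \<open>
  Downward induction on \<open>j\<close>: where \<open>u\<^sub>j < 0\<close>, the equation and \<open>u\<^sub>j\<^sub>+\<^sub>1 \<ge> 0\<close> give \<open>\<Delta>u\<^sub>j \<le> 0\<close>, so the weak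
  maximum principle applies. The origin is a removable boundary point because \<open>u\<^sub>j\<close> is bounded below.
\<close>

lemma u_nonneg: "j < m \<Longrightarrow> x \<in> \<Omega> - {0} \<Longrightarrow> 0 \<le> u j x"
proof (induction "m - j" arbitrary: j x rule: less_induct)
  case less
  note j = \<open>j < m\<close>
  have rhs: "0 \<le> (if Suc j < m then u (Suc j) y else f (u 0 y))" if y: "y \<in> \<Omega> - {0}" for y
  proof (cases "Suc j < m")
    case True
    then show ?thesis using less.hyps[of "Suc j" y] y by simp
  next
    case False
    have "f 0 \<le> f (u 0 y)" using u0_pos[OF y] by (intro f_mono) auto
    then show ?thesis using False f_nonneg by simp
  qed
  obtain c where c: "c > 0" "\<And>(x0::real ^ 'n) r. 0 < r \<Longrightarrow> bump_mean (\<lambda>_. 1) x0 r = c"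
    using bump_mass by blast
  let ?V = "\<Omega> - {0}"
  \<comment> \<open>As \<open>n / 2 \<ge> 1\<close> and \<open>R \<ge> 1\<close>, the power of \<open>R\<close> is at least \<open>R\<close>, which absorbs the measure of \<open>\<Omega>\<close>.\<close>
  define R where "R = max 1 (16 * measure lebesgue ?V / c)"
  have "R powr 1 \<le> R powr (real CARD('n) / 2)" using dim by (intro powr_mono) (auto simp: R_def)
  then have "R \<le> R powr (real CARD('n) / 2)" by (simp add: R_def)
  moreover have "measure lebesgue ?V \<le> c / 16 * R" using c by (auto simp: R_def field_simps max_def)
  ultimately have small: "measure lebesgue ?V \<le> c / 16 * R powr (real CARD('n) / 2)"
    using c(1) by (smt (verit) mult_left_mono divide_nonneg_nonneg)
  show ?case
  proof (rule maximum_principle_system[where V = ?V and a = 0 and J = "{j}" and w = u and C = 0 and S = ?V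
        and B = B and R = R and c = c])
    show "bounded ?V" using bounded_\<Omega> by (rule bounded_subset) auto
    then show "?V \<in> lmeasurable" using open_punctured by (rule lmeasurable_open)
    fix i y assume "i \<in> {j}" "y \<in> ?V" "u i y < 0"
    then show "(\<Sum>ia\<in>UNIV. u2 i ia y) \<le> 0 * \<mu>" for \<mu>
      using laplacian_u[OF j, of y] rhs[of y] mult_nonneg_nonpos[OF \<alpha>_nonneg[OF j], of "u j y"] by auto
  next
    fix i b and e :: real assume b: "i \<in> {j}" "b \<in> frontier ?V" "b \<noteq> 0" and e: "0 < e"
    have "b \<in> closure ?V" "b \<notin> ?V" using b open_punctured by (auto simp: frontier_def interior_open)
    then have "b \<in> frontier \<Omega>" using b by (intro frontier_\<Omega>I[of b ?V]) auto
    from eventually_abs_u_less[OF j this e] show "\<forall>\<^sub>F x in at b within ?V. - e < u i x"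
      unfolding eventually_at_filter by eventually_elim (use b in auto)
  qed (use dim open_punctured twice_diff_u j u_below c small less.prems in \<open>auto simp: R_def\<close>)
qed

lemma rhs_nonneg:
  assumes "x \<in> \<Omega> - {0}"
  shows "0 \<le> (if Suc j < m then u (Suc j) x else f (u 0 x))"
  using u_nonneg[of "Suc j" x] f_mono[of 0 "u 0 x"] u0_pos[OF assms] f_nonneg assms by auto

text \<open>
  The strong maximum principle on the connected set \<open>\<Omega> - {0}\<close>. In the second case, which occurs for
  instance for \<open>j = m - 1 > 0\<close> and \<open>f = 0\<close>, the difference of \<open>u\<^sub>j\<close> and its reflection is identically zero.
\<close>

lemma u_pos_or_zero:
  assumes j: "j < m"
  shows "(\<forall>x\<in>\<Omega> - {0}. 0 < u j x) \<or> (\<forall>x\<in>\<Omega> - {0}. u j x = 0)"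
proof (rule ccontr)
  assume "\<not> ?thesis"
  then obtain x y where x: "x \<in> \<Omega> - {0}" "\<not> 0 < u j x" and y: "y \<in> \<Omega> - {0}" "u j y \<noteq> 0" by blast
  have "u j x = 0" using x u_nonneg[OF j x(1)] by simp
  have conn: "connected (\<Omega> - {0})"
    using connected_open_delete[OF open_\<Omega> connected_\<Omega>] dim by simp
  have "u j y = 0"
  proof (rule strong_maximum_principle[OF twice_diff_u[OF j] open_punctured u_nonneg[OF j] _ \<alpha>_nonneg[OF j] conn order_refl
          x(1) \<open>u j x = 0\<close> y(1)])
    show "(\<Sum>i\<in>UNIV. u2 j i z) \<le> \<alpha> j * u j z" if "z \<in> \<Omega> - {0}" for z
      unfolding laplacian_u[OF j that] using rhs_nonneg[OF that, of j] by simp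
  qed
  then show False using y by simp
qed

text \<open>
  By symmetry and convexity the lines in direction \<open>k\<close> meet \<open>\<Omega>\<close> in symmetric intervals.
\<close>

lemma column_in_\<Omega>:
  assumes x: "x \<in> \<Omega>" and le: "\<bar>y $ k\<bar> \<le> x $ k" and eq: "\<And>j. j \<noteq> k \<Longrightarrow> y $ j = x $ j"
  shows "y \<in> \<Omega>"
proof (cases "x $ k = 0")
  case True
  then have "y $ j = x $ j" for j using le eq by (cases "j = k") auto
  then have "y = x" by (simp add: vec_eq_iff)
  then show ?thesis using x by simp
next
  case False
  then have pos: "0 < x $ k" using le by linarith
  let ?t = "(x $ k - y $ k) / (2 * x $ k)"
  have "reflect k x \<in> \<Omega>" using symmetric_\<Omega> x by (auto simp: symmetric_in_def)
  moreover have "?t \<in> {0..1}" using le pos by (auto simp: field_simps)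
  moreover have "\<forall>j. j \<noteq> k \<longrightarrow> x $ j = reflect k x $ j" by (simp add: reflect_def)
  ultimately have "(1 - ?t) *\<^sub>R x + ?t *\<^sub>R reflect k x \<in> \<Omega>"
    using convex_\<Omega> x unfolding convex_in_direction_def by blast
  moreover have "(1 - ?t) *\<^sub>R x + ?t *\<^sub>R reflect k x = y"
    using pos by (auto simp: vec_eq_iff reflect_def eq field_simps)
  ultimately show ?thesis by simp
qed

section \<open>Comparison with the reflected system\<close>

text \<open>
  The mirror image of the singular point is left out, so that the reflected \<open>u\<close> is smooth on the cap.
\<close>

definition cap :: "real \<Rightarrow> (real ^ 'n) set" where
  "cap l = {x \<in> \<Omega>. l < x $ k} - {reflect_at k l 0}"

text \<open>
  Written as a sum, to match the closure lemmas for \<open>twice_diff_on\<close>.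
\<close>

definition w :: "real \<Rightarrow> nat \<Rightarrow> real ^ 'n \<Rightarrow> real" where
  "w l j x = u j (reflect_at k l x) + (- 1) * u j x"

lemma cap_subset:
  assumes "0 \<le> l" "x \<in> cap l"
  shows "x \<in> \<Omega> - {0}" "reflect_at k l x \<in> \<Omega> - {0}" "l < x $ k"
proof -
  show "x \<in> \<Omega> - {0}" "l < x $ k" using assms by (auto simp: cap_def)
  have "reflect_at k l x \<in> \<Omega>"
    by (rule column_in_\<Omega>[of x]) (use assms in \<open>auto simp: cap_def reflect_at_nth\<close>)
  moreover have "reflect_at k l x \<noteq> 0"
    using assms reflect_at_involutive[of k l x] by (auto simp: cap_def simp del: reflect_at_involutive)
  ultimately show "reflect_at k l x \<in> \<Omega> - {0}" by simp
qed

text \<open>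
  Openness in \<open>(l, x)\<close> jointly allows perturbing the plane and the point at the same time.
\<close>

lemma open_cap_graph: "open {(l, x). 0 < l \<and> x \<in> cap l}"
proof -
  have "{(l, x). 0 < l \<and> x \<in> cap l} =
     {p. 0 < fst p} \<inter> {p. fst p < snd p $ k} \<inter> {p. snd p \<noteq> reflect_at k (fst p) 0} \<inter> snd -` \<Omega>"
    by (auto simp: cap_def)
  then show ?thesis
    by (auto intro!: open_Int open_Collect_less open_Collect_neq continuous_intros open_vimage_snd open_\<Omega>)
qed

lemma open_cap: "open (cap l)"
proof -
  have "cap l = \<Omega> \<inter> {x. l < x $ k} - {reflect_at k l 0}" by (auto simp: cap_def)
  then show ?thesis
    by (auto intro!: open_Diff open_Int open_Collect_less continuous_intros open_\<Omega>)
qed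

lemma continuous_on_w_graph:
  assumes "j < m"
  shows "continuous_on {(l, x). 0 < l \<and> x \<in> cap l} (\<lambda>p. w (fst p) j (snd p))"
proof -
  let ?G = "{(l, x). 0 < l \<and> x \<in> cap l}"
  note c = twice_diff_onD(1)[OF twice_diff_u[OF assms]]
  have "(\<lambda>p. reflect_at k (fst p) (snd p)) ` ?G \<subseteq> \<Omega> - {0}" "snd ` ?G \<subseteq> \<Omega> - {0}"
    using cap_subset(1,2) less_imp_le by (auto, blast+)
  moreover have "continuous_on ?G (\<lambda>p. reflect_at k (fst p) (snd p))" "continuous_on ?G snd"
    by (intro continuous_intros)+
  ultimately show ?thesis
    unfolding w_def by (intro continuous_on_add continuous_on_mult_left continuous_on_compose2[OF c])
qed

lemma twice_diff_on_w:
  assumes "0 \<le> l" "j < m"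
  shows "twice_diff_on (cap l) (w l j)
     (\<lambda>i x. (if i = k then - 1 else 1) * u1 j i (reflect_at k l x) + (- 1) * u1 j i x)
     (\<lambda>i x. u2 j i (reflect_at k l x) + (- 1) * u2 j i x)"
  unfolding w_def[abs_def]
  by (intro twice_diff_on_add twice_diff_on_cmult twice_diff_on_reflect_at[OF twice_diff_u[OF assms(2)]]
      twice_diff_on_subset[OF twice_diff_u[OF assms(2)]])
    (use cap_subset[OF assms(1)] in auto)

lemma laplacian_w:
  assumes "0 \<le> l" "j < m" "x \<in> cap l"
  shows "(\<Sum>i\<in>UNIV. u2 j i (reflect_at k l x) + (- 1) * u2 j i x) =
     \<alpha> j * w l j x - (if Suc j < m then w l (Suc j) x else f (u 0 (reflect_at k l x)) - f (u 0 x))"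
proof -
  have eq: "(\<Sum>i\<in>UNIV. u2 j i (reflect_at k l x) + (- 1) * u2 j i x) =
      (\<Sum>i\<in>UNIV. u2 j i (reflect_at k l x)) - (\<Sum>i\<in>UNIV. u2 j i x)"
    by (simp add: sum_subtractf)
  show ?thesis
    unfolding eq laplacian_u[OF assms(2) cap_subset(1)[OF assms(1,3)]]
      laplacian_u[OF assms(2) cap_subset(2)[OF assms(1,3)]]
    by (simp add: w_def algebra_simps)
qed

text \<open>
  Where \<open>w\<^sub>j < 0\<close> the term \<open>\<alpha>\<^sub>j w\<^sub>j\<close> has the good sign, and the coupling is at most \<open>\<mu>\<close>; in the last equation
  it is at most \<open>L \<mu>\<close> because \<open>f\<close> is nondecreasing and Lipschitz.
\<close>

lemma laplacian_w_le:
  assumes l: "0 \<le> l" and \<mu>: "0 \<le> \<mu>" and below: "\<And>j y. j < m \<Longrightarrow> y \<in> cap l \<Longrightarrow> - \<mu> \<le> w l j y"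
    and j: "j < m" and x: "x \<in> cap l" and neg: "w l j x < 0"
  shows "(\<Sum>i\<in>UNIV. u2 j i (reflect_at k l x) + (- 1) * u2 j i x) \<le> (1 + L) * \<mu>"
proof -
  have 1: "\<alpha> j * w l j x \<le> 0" using \<alpha>_nonneg[OF j] neg by (intro mult_nonneg_nonpos) auto
  have "0 \<le> L * \<mu>" using L_nonneg \<mu> by simp
  moreover have "- (if Suc j < m then w l (Suc j) x else f (u 0 (reflect_at k l x)) - f (u 0 x)) \<le> \<mu> + L * \<mu>"
  proof (cases "Suc j < m")
    case True
    then show ?thesis using below[of "Suc j" x] x \<open>0 \<le> L * \<mu>\<close> by simp
  next
    case False
    have p: "0 < u 0 x" "0 < u 0 (reflect_at k l x)" using cap_subset[OF l x] u0_pos by auto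
    have "f (u 0 x) - f (u 0 (reflect_at k l x)) \<le> L * \<mu>"
    proof (cases "u 0 x \<le> u 0 (reflect_at k l x)")
      case True
      then show ?thesis using f_mono[of "u 0 x"] p \<open>0 \<le> L * \<mu>\<close> by fastforce
    next
      case False
      have "f (u 0 x) - f (u 0 (reflect_at k l x)) \<le> L * (u 0 x - u 0 (reflect_at k l x))"
        using False p by (intro f_lipschitz) auto
      also have "\<dots> \<le> L * \<mu>"
        using below[OF m_pos x] L_nonneg by (intro mult_left_mono) (auto simp: w_def)
      finally show ?thesis .
    qed
    then show ?thesis using False \<mu> by simp
  qed
  ultimately show ?thesis unfolding laplacian_w[OF l j x] using 1 by (simp add: algebra_simps)
qed

text \<open>
  A boundary point of the cap lies either in \<open>\<Omega>\<close> and on the plane, where \<open>w\<^sub>j\<close> vanishes, or on the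
  boundary of \<open>\<Omega>\<close>, where \<open>u\<^sub>j\<close> tends to \<open>0\<close> while its reflection stays nonnegative.
\<close>

lemma w_boundary:
  assumes l: "0 < l" and j: "j < m" and b: "b \<in> frontier (cap l)" "b \<noteq> reflect_at k l 0" and e: "0 < e"
  shows "\<forall>\<^sub>F x in at b within cap l. - e < w l j x"
proof (cases "b \<in> \<Omega>")
  case False
  have "b \<in> closure (cap l)" using b by (simp add: frontier_def)
  then have "b \<in> frontier \<Omega>" using False by (intro frontier_\<Omega>I[of b "cap l"]) (auto simp: cap_def)
  from eventually_abs_u_less[OF j this e] show ?thesis
    unfolding eventually_at_filter
  proof eventually_elim
    case (elim x)
    show ?case
    proof (intro impI)
      assume "x \<in> cap l"
      then have x: "x \<in> \<Omega> - {0}" "reflect_at k l x \<in> \<Omega> - {0}" using cap_subset[of l x] l by auto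
      show "- e < w l j x" using elim x(1) u_nonneg[OF j x(2)] by (auto simp: w_def)
    qed
  qed
next
  case True
  have bn: "b \<in> closure (cap l)" "b \<notin> cap l"
    using b open_cap by (auto simp: frontier_def interior_open)
  have "cap l \<subseteq> {x. l \<le> x $ k}" by (auto simp: cap_def)
  moreover have "closed {x::real ^ 'n. l \<le> x $ k}" by (intro closed_Collect_le continuous_intros)
  ultimately have "l \<le> b $ k" using bn(1) closure_minimal by blast
  then have bk: "b $ k = l" using bn(2) b True by (auto simp: cap_def)
  then have rb: "reflect_at k l b = b" by (simp add: reflect_at_def)
  have b0: "b \<in> \<Omega> - {0}" using True bk l by auto
  have "isCont (\<lambda>x. reflect_at k l x) b"
    using continuous_on_reflect_at[OF continuous_on_id continuous_on_const, of UNIV k l]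
    by (simp add: continuous_on_eq_continuous_at)
  then have "isCont (\<lambda>x. u j (reflect_at k l x)) b"
    by (rule isCont_o2) (simp add: rb isCont_u[OF j b0])
  then have "isCont (w l j) b" unfolding w_def[abs_def] using isCont_u[OF j b0] by (intro continuous_intros)
  then have "(w l j \<longlongrightarrow> w l j b) (at b within cap l)"
    using continuous_at_imp_continuous_within continuous_within by blast
  moreover have "w l j b = 0" by (simp add: w_def rb)
  ultimately show ?thesis using e order_tendstoD(1)[of "w l j" 0 "at b within cap l" "- e"] by simp
qed

text \<open>
  Extended by zero, \<open>u\<^sub>j\<close> is continuous on the compact closure of the cap, which avoids the origin.
\<close>

lemma u_bounded_above_on_cap:
  assumes l: "0 < l" and j: "j < m"
  obtains M where "\<And>x. x \<in> cap l \<Longrightarrow> u j x \<le> M"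
proof -
  let ?C = "closure \<Omega> \<inter> {x. l \<le> x $ k}"
  define g where "g x = (if x \<in> \<Omega> then u j x else 0)" for x
  have "compact ?C" using bounded_\<Omega>
    by (intro compact_Int_closed) (auto simp: compact_closure intro!: closed_Collect_le continuous_intros)
  moreover have "continuous_on ?C g"
    unfolding continuous_on_def
  proof
    fix b assume b: "b \<in> ?C"
    show "(g \<longlongrightarrow> g b) (at b within ?C)"
    proof (cases "b \<in> \<Omega>")
      case True
      then have "b \<in> \<Omega> - {0}" using b l by auto
      from isCont_u[OF j this] have "(u j \<longlongrightarrow> g b) (at b)" using True by (simp add: isCont_def g_def)
      moreover have "\<forall>\<^sub>F x in at b. u j x = g x"
        using eventually_at_in_open'[OF open_\<Omega> True] by eventually_elim (simp add: g_def)
      ultimately have "(g \<longlongrightarrow> g b) (at b)" by (rule Lim_transform_eventually)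
      then show ?thesis by (rule tendsto_within_subset) auto
    next
      case False
      then have fr: "b \<in> frontier \<Omega>" using b open_\<Omega> by (auto simp: frontier_def interior_open)
      show ?thesis
      proof (rule tendstoI)
        fix e :: real assume e: "0 < e"
        from eventually_abs_u_less[OF j fr e] show "\<forall>\<^sub>F x in at b within ?C. dist (g x) (g b) < e"
          unfolding eventually_at_filter
          by eventually_elim (use l e False in \<open>auto simp: g_def\<close>)
      qed
    qed
  qed
  ultimately have "bounded (g ` ?C)" using compact_continuous_image compact_imp_bounded by blast
  then obtain M where M: "\<And>y. y \<in> g ` ?C \<Longrightarrow> norm y \<le> M" unfolding bounded_iff by blast
  have "u j x \<le> M" if "x \<in> cap l" for x
  proof -
    have "x \<in> ?C" "x \<in> \<Omega>" using that closure_subset[of \<Omega>] by (auto simp: cap_def)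
    then have "norm (g x) \<le> M" using M by blast
    then show ?thesis using \<open>x \<in> \<Omega>\<close> by (simp add: g_def)
  qed
  then show ?thesis by (rule that)
qed

lemma w_bounded_below:
  assumes l: "0 < l"
  obtains M where "\<And>j x. j < m \<Longrightarrow> x \<in> cap l \<Longrightarrow> - M \<le> w l j x"
proof -
  have "\<forall>j\<in>{..<m}. \<exists>M. \<forall>x\<in>cap l. u j x \<le> M" using u_bounded_above_on_cap[OF l] by (metis lessThan_iff)
  then obtain M where M: "\<And>j x. j < m \<Longrightarrow> x \<in> cap l \<Longrightarrow> u j x \<le> M j" by (metis lessThan_iff)
  have "- (\<Sum>j<m. \<bar>M j\<bar>) \<le> w l j x" if "j < m" "x \<in> cap l" for j x
  proof -
    have "\<bar>M j\<bar> \<le> (\<Sum>j<m. \<bar>M j\<bar>)" using that by (intro member_le_sum) auto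
    moreover have "0 \<le> u j (reflect_at k l x)" using cap_subset(2)[of l x] l that u_nonneg by simp
    ultimately show ?thesis using M[OF that] by (simp add: w_def)
  qed
  then show ?thesis by (rule that)
qed

section \<open>Moving the plane\<close>

definition ordered :: "real \<Rightarrow> bool" where
  "ordered l \<longleftrightarrow> (\<forall>j<m. \<forall>x\<in>cap l. 0 \<le> w l j x)"

text \<open>
  A plane that does not meet \<open>\<Omega>\<close> has an empty cap.
\<close>

lemma ordered_large:
  obtains l where "0 < l" "ordered l"
proof -
  obtain \<rho> where \<rho>: "\<And>x. x \<in> \<Omega> \<Longrightarrow> norm x \<le> \<rho>" using bounded_\<Omega> unfolding bounded_iff by blast
  have "cap (\<bar>\<rho>\<bar> + 1) = {}"
  proof -
    have "x $ k \<le> \<bar>\<rho>\<bar>" if "x \<in> \<Omega>" for x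
      using \<rho>[OF that] component_le_norm_cart[of x k] by linarith
    then show ?thesis by (force simp: cap_def)
  qed
  then have "ordered (\<bar>\<rho>\<bar> + 1)" by (simp add: ordered_def)
  then show ?thesis by (rule that[rotated]) simp
qed

text \<open>
  The factor \<open>\<sigma>\<close> is \<open>1\<close> for persistence of positivity and \<open>- 1\<close> for persistence of a negative value.
\<close>

lemma eventually_w_pos:
  assumes l: "0 < l" and j: "j < m" and K: "compact K" "K \<subseteq> cap l" and pos: "\<And>x. x \<in> K \<Longrightarrow> 0 < \<sigma> * w l j x"
  shows "\<forall>\<^sub>F l' in nhds l. \<forall>x\<in>K. x \<in> cap l' \<and> 0 < \<sigma> * w l' j x"
proof -
  let ?O = "{(l, x). 0 < l \<and> x \<in> cap l}"
  let ?W = "?O \<inter> (\<lambda>p. \<sigma> * w (fst p) j (snd p)) -` {0<..}"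
  have "open ?W"
    by (rule continuous_open_preimage[OF continuous_on_mult_left[OF continuous_on_w_graph[OF j]] open_cap_graph]) simp
  then have "\<forall>\<^sub>F l' in nhds l. \<forall>x\<in>K. (l', x) \<in> ?W"
    by (rule eventually_nhds_tube[OF K(1)]) (use l K pos in auto)
  then show ?thesis by eventually_elim auto
qed

lemma eventually_not_ordered:
  assumes "0 < l" "\<not> ordered l"
  shows "\<forall>\<^sub>F l' in nhds l. \<not> ordered l'"
proof -
  obtain j x where jx: "j < m" "x \<in> cap l" "w l j x < 0" using assms(2) by (auto simp: ordered_def not_le)
  have "\<forall>\<^sub>F l' in nhds l. \<forall>y\<in>{x}. y \<in> cap l' \<and> 0 < (- 1) * w l' j y"
    by (rule eventually_w_pos[OF assms(1) jx(1)]) (use jx in auto)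
  then show ?thesis by eventually_elim (use jx(1) in \<open>force simp: ordered_def\<close>)
qed

text \<open>
  If all components are ordered, the coupling terms have a sign, and each \<open>w\<^sub>j\<close> is a nonnegative
  supersolution to which the strong maximum principle applies.
\<close>

lemma laplacian_w_le_of_ordered:
  assumes l: "0 < l" "ordered l" and j: "j < m" and x: "x \<in> cap l"
  shows "(\<Sum>i\<in>UNIV. u2 j i (reflect_at k l x) + (- 1) * u2 j i x) \<le> \<alpha> j * w l j x"
proof -
  have "0 \<le> (if Suc j < m then w l (Suc j) x else f (u 0 (reflect_at k l x)) - f (u 0 x))"
  proof (cases "Suc j < m")
    case True
    then show ?thesis using l x by (simp add: ordered_def)
  next
    case False
    have "0 < u 0 x" using cap_subset(1)[OF less_imp_le[OF l(1)] x] u0_pos by blast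
    moreover have "u 0 x \<le> u 0 (reflect_at k l x)" using l(2) m_pos x by (auto simp: ordered_def w_def)
    ultimately have "f (u 0 x) \<le> f (u 0 (reflect_at k l x))" by (intro f_mono) auto
    then show ?thesis using False by simp
  qed
  then show ?thesis unfolding laplacian_w[OF less_imp_le[OF l(1)] j x] by simp
qed

text \<open>
  The exit point above \<open>x\<close> is the end of an interval, because \<open>\<Omega>\<close> is convex in direction \<open>k\<close>.
\<close>

lemma column_top:
  assumes x: "x \<in> \<Omega>" "0 < x $ k"
  obtains h where "0 < h" "\<And>t. 0 \<le> t \<Longrightarrow> t < h \<Longrightarrow> x + t *\<^sub>R axis k 1 \<in> \<Omega>"
    "x + h *\<^sub>R axis k 1 \<in> frontier \<Omega>"
proof -
  let ?e = "axis k 1 :: real ^ 'n"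
  define T where "T = {t. 0 \<le> t \<and> x + t *\<^sub>R ?e \<in> \<Omega>}"
  define h where "h = Sup T"
  obtain \<rho> where \<rho>: "\<And>x. x \<in> \<Omega> \<Longrightarrow> norm x \<le> \<rho>" using bounded_\<Omega> unfolding bounded_iff by blast
  have T0: "0 \<in> T" using x by (simp add: T_def)
  have "t \<le> \<rho>" if "t \<in> T" for t
    using that \<rho>[of "x + t *\<^sub>R ?e"] component_le_norm_cart[of "x + t *\<^sub>R ?e" k] x by (auto simp: T_def)
  then have bdd: "bdd_above T" by (rule bdd_aboveI)
  have below: "x + t *\<^sub>R ?e \<in> \<Omega>" if t: "0 \<le> t" "t < h" for t
  proof -
    have "T \<noteq> {}" using T0 by blast
    from less_cSup_iff[OF this bdd, of t] obtain s where s: "s \<in> T" "t < s"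
      using t(2) unfolding h_def by blast
    show ?thesis
      by (rule column_in_\<Omega>[of "x + s *\<^sub>R ?e"]) (use s x t in \<open>auto simp: T_def axis_def\<close>)
  qed
  have h0: "0 \<le> h" using T0 bdd cSup_upper by (auto simp: h_def)
  have top: "x + h *\<^sub>R ?e \<notin> \<Omega>"
  proof
    assume "x + h *\<^sub>R ?e \<in> \<Omega>"
    from eventually_axis_shift_in_open[OF open_\<Omega> this, of k]
    obtain d where d: "0 < d" "\<And>t. dist t 0 < d \<Longrightarrow> x + h *\<^sub>R ?e + t *\<^sub>R ?e \<in> \<Omega>"
      unfolding eventually_nhds_metric by blast
    have "x + h *\<^sub>R ?e + (d / 2) *\<^sub>R ?e \<in> \<Omega>" using d by (intro d(2)) simp
    then have "h + d / 2 \<in> T" using h0 d by (simp add: T_def scaleR_add_left add.assoc)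
    then show False using cSup_upper[OF _ bdd, of "h + d / 2"] d by (simp add: h_def)
  qed
  have "h \<noteq> 0" using top x by auto
  then have hpos: "0 < h" using h0 by simp
  have "((\<lambda>t. x + t *\<^sub>R ?e) \<longlongrightarrow> x + h *\<^sub>R ?e) (at_left h)" by (intro tendsto_intros)
  moreover have "\<forall>\<^sub>F t in at_left h. x + t *\<^sub>R ?e \<in> closure \<Omega>"
    unfolding eventually_at_left_field using hpos below closure_subset[of \<Omega>]
    by (intro exI[of _ 0]) auto
  ultimately have "x + h *\<^sub>R ?e \<in> closure \<Omega>"
    by (intro Lim_in_closed_set[of "closure \<Omega>" _ "at_left h"]) auto
  then have "x + h *\<^sub>R ?e \<in> frontier \<Omega>" using top by (intro frontier_\<Omega>I[of _ \<Omega>]) auto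
  with hpos below show ?thesis by (rule that)
qed

text \<open>
  A zero of \<open>w\<^sub>j\<close> spreads to a ball by the strong maximum principle, hence to a whole vertical segment
  that ends on the boundary of \<open>\<Omega>\<close>. At the end point \<open>u\<^sub>j\<close> vanishes, but its mirror image lies inside \<open>\<Omega>\<close>,
  where \<open>u\<^sub>j\<close> is positive. This contradicts \<open>w\<^sub>j = 0\<close> along the segment.
\<close>

lemma w_pos:
  assumes l: "0 < l" "ordered l" and j: "j < m" and pos: "\<And>x. x \<in> \<Omega> - {0} \<Longrightarrow> 0 < u j x" and x0: "x0 \<in> cap l"
  shows "0 < w l j x0"
proof (rule ccontr)
  let ?e = "axis k 1 :: real ^ 'n"
  assume "\<not> 0 < w l j x0"
  moreover have "0 \<le> w l j x0" using l(2) j x0 unfolding ordered_def by blast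
  ultimately have w0: "w l j x0 = 0" by linarith
  have smp: "w l j y = 0" if "connected S" "S \<subseteq> cap l" "x \<in> S" "w l j x = 0" "y \<in> S" for S x y
    by (rule strong_maximum_principle[OF twice_diff_on_w[OF less_imp_le[OF l(1)] j] open_cap _
          laplacian_w_le_of_ordered[OF l j] \<alpha>_nonneg[OF j] that]) (use l j in \<open>auto simp: ordered_def\<close>)
  obtain r where r: "0 < r" "cball x0 r \<subseteq> cap l" using x0 open_cap open_contains_cball by blast
  obtain q where q: "q \<noteq> k"
  proof -
    have "card (UNIV :: 'n set) \<noteq> card {k}" using dim by simp
    then have "UNIV \<noteq> {k}" by metis
    then show ?thesis using that by auto
  qed
  \<comment> \<open>A point off the \<open>k\<close>-axis: the column above it misses the reflected origin, and the
    reflection of its top misses the origin. This is where the dimension is at least two.\<close>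
  obtain x1 where x1: "x1 \<in> ball x0 r" "x1 $ q \<noteq> 0"
  proof (cases "x0 $ q = 0")
    case True
    have "x0 + (r / 2) *\<^sub>R axis q 1 \<in> ball x0 r" using r by (simp add: dist_norm)
    moreover have "(x0 + (r / 2) *\<^sub>R axis q 1) $ q \<noteq> 0" using True r by simp
    ultimately show ?thesis by (rule that)
  next
    case False
    then show ?thesis using r by (intro that[of x0]) auto
  qed
  have x1c: "x1 \<in> cap l" using x1 r by auto
  have w1: "w l j x1 = 0"
    by (rule smp[of "ball x0 r" x0]) (use r w0 x1 ball_subset_cball in auto)
  have x1k: "x1 \<in> \<Omega>" "l < x1 $ k" using cap_subset[OF less_imp_le[OF l(1)] x1c] by auto
  obtain h where h: "0 < h" "\<And>t. 0 \<le> t \<Longrightarrow> t < h \<Longrightarrow> x1 + t *\<^sub>R ?e \<in> \<Omega>" "x1 + h *\<^sub>R ?e \<in> frontier \<Omega>"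
    using column_top[OF x1k(1)] x1k l by auto
  let ?top = "x1 + h *\<^sub>R ?e"
  let ?S = "(\<lambda>t. x1 + t *\<^sub>R ?e) ` {0..<h}"
  have nz: "(x1 + t *\<^sub>R ?e) $ q \<noteq> 0" for t using x1 q by (simp add: axis_def)
  have S: "?S \<subseteq> cap l"
  proof (rule image_subsetI)
    fix t assume t: "t \<in> {0..<h}"
    have "reflect_at k l 0 $ q = 0" using q by (simp add: reflect_at_nth)
    then have "x1 + t *\<^sub>R ?e \<noteq> reflect_at k l 0" using nz[of t] by metis
    then show "x1 + t *\<^sub>R ?e \<in> cap l" using h(2)[of t] t x1k by (simp add: cap_def)
  qed
  have "connected ?S" by (intro connected_continuous_image continuous_intros) auto
  then have wS: "w l j (x1 + t *\<^sub>R ?e) = 0" if "0 \<le> t" "t < h" for t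
    by (rule smp[of ?S x1]) (use S that h(1) w1 in \<open>auto intro: image_eqI[of _ _ 0]\<close>)
  have lim: "((\<lambda>t. x1 + t *\<^sub>R ?e) \<longlongrightarrow> ?top) (at_left h)" by (intro tendsto_intros)
  have near: "\<forall>\<^sub>F t in at_left h. 0 < t \<and> t < h"
    unfolding eventually_at_left_field using h(1) by (intro exI[of _ 0]) auto
  have u_lim: "((\<lambda>t. u j (x1 + t *\<^sub>R ?e)) \<longlongrightarrow> 0) (at_left h)"
  proof (rule tendstoI)
    fix e :: real assume e: "0 < e"
    from eventually_abs_u_less[OF j h(3) e]
    have "\<forall>\<^sub>F t in at_left h. x1 + t *\<^sub>R ?e \<in> \<Omega> - {0} \<longrightarrow> \<bar>u j (x1 + t *\<^sub>R ?e)\<bar> < e"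
      by (rule eventually_compose_filterlim) (rule lim)
    with near show "\<forall>\<^sub>F t in at_left h. dist (u j (x1 + t *\<^sub>R ?e)) 0 < e"
    proof eventually_elim
      case (elim t)
      have "x1 + t *\<^sub>R ?e \<noteq> 0" using nz[of t] by (metis zero_index)
      then show ?case using elim h(2)[of t] by simp
    qed
  qed
  have rtop: "reflect_at k l ?top \<in> \<Omega> - {0}"
  proof -
    \<comment> \<open>A height below \<open>h\<close> whose point has a \<open>k\<close>-coordinate dominating that of the reflected top.\<close>
    define t where "t = max 0 (\<bar>2 * l - (x1 $ k + h)\<bar> - x1 $ k)"
    have t: "0 \<le> t" "t < h" using x1k l h(1) by (auto simp: t_def)
    have "reflect_at k l ?top \<in> \<Omega>"
      by (rule column_in_\<Omega>[OF h(2)[OF t]]) (auto simp: reflect_at_nth t_def axis_def)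
    moreover have "reflect_at k l ?top $ q \<noteq> 0" using nz[of h] q by (simp add: reflect_at_nth)
    ultimately show ?thesis by (metis DiffI singletonD zero_index)
  qed
  have "isCont (\<lambda>x. reflect_at k l x) ?top"
    using continuous_on_reflect_at[OF continuous_on_id continuous_on_const, of UNIV k l]
    by (simp add: continuous_on_eq_continuous_at)
  then have "isCont (\<lambda>x. u j (reflect_at k l x)) ?top"
    by (rule isCont_o2) (rule isCont_u[OF j rtop])
  then have "((\<lambda>t. u j (reflect_at k l (x1 + t *\<^sub>R ?e))) \<longlongrightarrow> u j (reflect_at k l ?top)) (at_left h)"
    by (rule isCont_tendsto_compose) (rule lim)
  moreover have "\<forall>\<^sub>F t in at_left h. u j (reflect_at k l (x1 + t *\<^sub>R ?e)) = u j (x1 + t *\<^sub>R ?e)"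
    using near by eventually_elim (use wS in \<open>auto simp: w_def\<close>)
  ultimately have "((\<lambda>t. u j (x1 + t *\<^sub>R ?e)) \<longlongrightarrow> u j (reflect_at k l ?top)) (at_left h)"
    by (rule Lim_transform_eventually)
  then have "u j (reflect_at k l ?top) = 0"
    using u_lim by (rule tendsto_unique[rotated]) simp
  then show False using pos[OF rtop] by simp
qed

text \<open>
  A compact set \<open>K\<close> of the cap is chosen on which the nontrivial \<open>w\<^sub>j\<close> are positive for all planes near
  the given one. Outside \<open>K\<close>, all nearby caps lie in one set \<open>S\<close> of small measure, and the maximum
  principle for small sets applies.
\<close>

lemma eventually_ordered:
  assumes l: "0 < l" "ordered l"
  shows "\<forall>\<^sub>F l' in nhds l. ordered l'"
proof -
  obtain c where c: "c > 0" "\<And>(x0::real ^ 'n) r. 0 < r \<Longrightarrow> bump_mean (\<lambda>_. 1) x0 r = c"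
    using bump_mass by blast
  define R where "R = 1 / (4 * (1 + L))"
  have R: "0 < R" "(1 + L) * R \<le> 1 / 4" using L_nonneg by (auto simp: R_def field_simps)
  define \<delta> where "\<delta> = c / 16 * R powr (real CARD('n) / 2)"
  have \<delta>: "0 < \<delta>" using c R by (simp add: \<delta>_def)
  \<comment> \<open>The plane itself and the reflected origin are null sets, and \<open>T\<close> keeps a positive distance from them.\<close>
  define N where "N = insert (reflect_at k l 0) {x. x $ k = l}"
  have N: "negligible N" "closed N"
    unfolding N_def using negligible_standard_hyperplane[of "axis k 1 :: real ^ 'n" l]
    by (auto simp: inner_axis intro!: closed_Collect_eq continuous_intros)
  have "open (\<Omega> - N)" using open_\<Omega> N by (intro open_Diff)
  then have \<Omega>N: "\<Omega> - N \<in> lmeasurable" using bounded_\<Omega> by (intro lmeasurable_open) (auto intro: bounded_subset)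
  obtain T where T: "closed T" "T \<subseteq> \<Omega> - N" "\<Omega> - N - T \<in> lmeasurable" "emeasure lebesgue (\<Omega> - N - T) < ennreal \<delta>"
    using sets_lebesgue_inner_closed[of "\<Omega> - N" \<delta>] \<Omega>N \<delta> by blast
  define S where "S = (\<Omega> - N - T) \<union> N"
  have S: "S \<in> lmeasurable" "measure lebesgue S \<le> \<delta>"
  proof -
    show "S \<in> lmeasurable" unfolding S_def using T(3) negligible_imp_measurable[OF N(1)] by (rule fmeasurable.Un)
    have "measure lebesgue S = measure lebesgue (\<Omega> - N - T)"
      unfolding S_def using T(3) N(1) by (intro measure_Un_null_set) (auto simp: negligible_iff_null_sets)
    also have "\<dots> \<le> \<delta>"
      using T(3,4) \<delta> by (simp add: emeasure_eq_measure2 ennreal_less_iff)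
    finally show "measure lebesgue S \<le> \<delta>" .
  qed
  have "compact T" using T bounded_\<Omega> by (auto simp: compact_eq_bounded_closed intro: bounded_subset)
  define K where "K = T \<inter> {x. l \<le> x $ k}"
  have K: "compact K" "K \<subseteq> cap l"
    using \<open>compact T\<close> T(2) unfolding K_def
    by (auto intro!: compact_Int_closed closed_Collect_le continuous_intros simp: cap_def N_def)
  \<comment> \<open>Points of \<open>T\<close> on the other side of the plane stay on that side for nearby planes.\<close>
  have below: "\<forall>\<^sub>F l' in nhds l. \<forall>x\<in>T. x $ k < l \<longrightarrow> x $ k < l'"
  proof -
    have "\<forall>\<^sub>F l' in nhds l. \<forall>x\<in>T \<inter> {x. x $ k \<le> l}. (l', x) \<in> {p. snd p $ k < fst p}"
    proof (rule eventually_nhds_tube)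
      show "compact (T \<inter> {x. x $ k \<le> l})"
        using \<open>compact T\<close> by (intro compact_Int_closed closed_Collect_le continuous_intros)
      show "open {p :: real \<times> (real ^ 'n). snd p $ k < fst p}"
        by (intro open_Collect_less continuous_intros)
      show "(l, x) \<in> {p. snd p $ k < fst p}" if "x \<in> T \<inter> {x. x $ k \<le> l}" for x
        using that T(2) by (auto simp: N_def)
    qed
    then show ?thesis by eventually_elim auto
  qed
  have K_pos: "\<forall>\<^sub>F l' in nhds l. \<forall>j\<in>{..<m}. \<forall>x\<in>K. x \<in> cap l' \<longrightarrow> 0 \<le> w l' j x"
  proof (rule eventually_ball_finite)
    show "\<forall>j\<in>{..<m}. \<forall>\<^sub>F l' in nhds l. \<forall>x\<in>K. x \<in> cap l' \<longrightarrow> 0 \<le> w l' j x"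
    proof
      fix j assume "j \<in> {..<m}"
      then have j: "j < m" by simp
      from u_pos_or_zero[OF j] show "\<forall>\<^sub>F l' in nhds l. \<forall>x\<in>K. x \<in> cap l' \<longrightarrow> 0 \<le> w l' j x"
      proof
        assume pos: "\<forall>x\<in>\<Omega> - {0}. 0 < u j x"
        have "\<forall>\<^sub>F l' in nhds l. \<forall>x\<in>K. x \<in> cap l' \<and> 0 < 1 * w l' j x"
          by (rule eventually_w_pos[OF l(1) j K]) (use pos K(2) w_pos[OF l j] in auto)
        then show ?thesis by eventually_elim force
      next
        assume zero: "\<forall>x\<in>\<Omega> - {0}. u j x = 0"
        have "\<forall>\<^sub>F l' in nhds l. 0 < l'" using l(1) eventually_nhds_in_open[of "{0<..}" l] by simp
        then show ?thesis
        proof eventually_elim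
          case (elim l')
          show ?case
          proof (intro ballI impI)
            fix x assume "x \<in> cap l'"
            from cap_subset(1,2)[OF less_imp_le[OF elim] this] show "0 \<le> w l' j x" using zero by (simp add: w_def)
          qed
        qed
      qed
    qed
  qed simp
  have "\<forall>\<^sub>F l' in nhds l. 0 < l'" using l(1) eventually_nhds_in_open[of "{0<..}" l] by simp
  with below K_pos show ?thesis
  proof eventually_elim
    case (elim l')
    then have l': "0 < l'" "0 \<le> l'" by auto
    obtain M where M: "\<And>j x. j < m \<Longrightarrow> x \<in> cap l' \<Longrightarrow> - M \<le> w l' j x" using w_bounded_below[OF l'(1)] by blast
    have neg: "{x \<in> cap l'. w l' j x < 0} \<subseteq> S" if j: "j < m" for j
    proof
      fix x assume x: "x \<in> {x \<in> cap l'. w l' j x < 0}"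
      then have x\<Omega>: "x \<in> \<Omega>" "l' < x $ k" using cap_subset[OF l'(2), of x] by auto
      have "x \<notin> T"
      proof
        assume "x \<in> T"
        show False
        proof (cases "x $ k < l")
          case True
          then show False using elim(1) \<open>x \<in> T\<close> x\<Omega> by fastforce
        next
          case False
          then have "x \<in> K" using \<open>x \<in> T\<close> by (simp add: K_def)
          then have "0 \<le> w l' j x" using elim(2) j x by blast
          then show False using x by simp
        qed
      qed
      then show "x \<in> S" using x\<Omega> by (auto simp: S_def)
    qed
    have "0 \<le> w l' j x" if "j < m" "x \<in> cap l'" for j x
    proof (rule maximum_principle_system[where V = "cap l'" and a = "reflect_at k l' 0" and J = "{..<m}" and w = "w l'"
          and C = "1 + L" and S = S and B = M and R = R and c = c
          and ?w1.0 = "\<lambda>j i x. (if i = k then - 1 else 1) * u1 j i (reflect_at k l' x) + (- 1) * u1 j i x"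
          and ?w2.0 = "\<lambda>j i x. u2 j i (reflect_at k l' x) + (- 1) * u2 j i x"])
      show "bounded (cap l')" using bounded_\<Omega> by (rule bounded_subset) (auto simp: cap_def)
      show "reflect_at k l' 0 \<notin> cap l'" by (simp add: cap_def)
      show "twice_diff_on (cap l') (w l' j) (\<lambda>i x. (if i = k then - 1 else 1) * u1 j i (reflect_at k l' x) + (- 1) * u1 j i x)
          (\<lambda>i x. u2 j i (reflect_at k l' x) + (- 1) * u2 j i x)" if "j \<in> {..<m}" for j
        using that by (intro twice_diff_on_w[OF l'(2)]) simp
      show "\<forall>\<^sub>F x in at b within cap l'. - e < w l' j x"
        if "j \<in> {..<m}" "b \<in> frontier (cap l')" "b \<noteq> reflect_at k l' 0" "0 < e" for j b e
        using that by (intro w_boundary[OF l'(1)]) auto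
      show "(\<Sum>i\<in>UNIV. u2 j i (reflect_at k l' x) + (- 1) * u2 j i x) \<le> (1 + L) * \<mu>"
        if "0 \<le> \<mu>" "\<And>j y. j \<in> {..<m} \<Longrightarrow> y \<in> cap l' \<Longrightarrow> - \<mu> \<le> w l' j y"
          "j \<in> {..<m}" "x \<in> cap l'" "w l' j x < 0" for \<mu> j x
        by (rule laplacian_w_le[OF l'(2) that(1)]) (use that in auto)
      show "measure lebesgue S \<le> c / 16 * R powr (real CARD('n) / 2)" using S(2) by (simp add: \<delta>_def)
    qed (use dim open_cap M neg S R c L_nonneg that in auto)
    then show "ordered l'" by (simp add: ordered_def)
  qed
qed

lemma ordered_everywhere:
  assumes "0 < l"
  shows "ordered l"
proof -
  let ?G = "{l. 0 < l \<and> ordered l}" and ?H = "{l. 0 < l \<and> \<not> ordered l}"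
  have pos: "\<forall>\<^sub>F l' in nhds l. 0 < l'" if "0 < l" for l :: real
    using that eventually_nhds_in_open[of "{0<..}" l] by simp
  have "open ?G"
  proof (rule open_if_eventually_nhds)
    fix b assume "b \<in> ?G"
    then have "\<forall>\<^sub>F x in nhds b. 0 < x \<and> ordered x" using pos[of b] eventually_ordered[of b] by (intro eventually_conj) auto
    then show "\<forall>\<^sub>F x in nhds b. x \<in> ?G" by simp
  qed
  moreover have "open ?H"
  proof (rule open_if_eventually_nhds)
    fix b assume "b \<in> ?H"
    then have "\<forall>\<^sub>F x in nhds b. 0 < x \<and> \<not> ordered x" using pos[of b] eventually_not_ordered[of b] by (intro eventually_conj) auto
    then show "\<forall>\<^sub>F x in nhds b. x \<in> ?H" by simp
  qed
  ultimately have "?G \<inter> {0<..} = {} \<or> ?H \<inter> {0<..} = {}"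
    by (intro connectedD[of "{0<..}"]) auto
  moreover have "?G \<inter> {0<..} \<noteq> {}"
    using ordered_large by (metis (mono_tags, lifting) IntI empty_iff greaterThan_iff mem_Collect_eq)
  ultimately show ?thesis using assms by auto
qed

lemma u0_less_reflect_at:
  assumes "0 < l" "x \<in> cap l"
  shows "u 0 x < u 0 (reflect_at k l x)"
  using w_pos[OF assms(1) ordered_everywhere[OF assms(1)] m_pos u0_pos assms(2)] by (simp add: w_def)

text \<open>
  The limit \<open>l \<rightarrow> 0\<close> of the ordering.
\<close>

lemma u0_le_reflect:
  assumes x: "x \<in> \<Omega>" "0 < x $ k"
  shows "u 0 x \<le> u 0 (reflect k x)"
proof -
  have "reflect_at k 0 x \<in> \<Omega>" by (rule column_in_\<Omega>[of x]) (use x in \<open>auto simp: reflect_at_nth\<close>)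
  moreover have "reflect_at k 0 x $ k \<noteq> 0" using x by (simp add: reflect_at_nth)
  ultimately have "reflect_at k 0 x \<in> \<Omega> - {0}" by auto
  then have "isCont (u 0) (reflect_at k 0 x)" by (rule isCont_u[OF m_pos])
  moreover have "((\<lambda>l. reflect_at k l x) \<longlongrightarrow> reflect_at k 0 x) (at_right 0)"
    unfolding reflect_at_def by (intro tendsto_intros)
  ultimately have lim: "((\<lambda>l. u 0 (reflect_at k l x)) \<longlongrightarrow> u 0 (reflect k x)) (at_right 0)"
    unfolding reflect_eq_reflect_at by (rule isCont_tendsto_compose)
  have "u 0 x \<le> u 0 (reflect_at k l x)" if "0 < l" "l < x $ k / 2" for l
  proof -
    have "x \<noteq> reflect_at k l 0" using that by (auto simp: reflect_at_nth)
    then have "x \<in> cap l" using x that by (simp add: cap_def)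
    then show ?thesis using u0_less_reflect_at[OF that(1)] by (simp add: less_imp_le)
  qed
  then have "\<forall>\<^sub>F l in at_right 0. u 0 x \<le> u 0 (reflect_at k l x)"
    unfolding eventually_at_right_field using x by (intro exI[of _ "x $ k / 2"]) auto
  with lim show ?thesis by (rule tendsto_lowerbound) simp
qed

lemma reflect_punctured:
  assumes "x \<in> \<Omega> - {0}"
  shows "reflect_at k 0 x \<in> \<Omega> - {0}"
proof -
  have "reflect_at k 0 x \<in> \<Omega>"
    using symmetric_\<Omega> assms unfolding symmetric_in_def reflect_eq_reflect_at by blast
  moreover have "reflect_at k 0 x \<noteq> 0"
  proof
    assume "reflect_at k 0 x = 0"
    then have "x = reflect_at k 0 0" by (metis reflect_at_involutive)
    then show False using assms by (simp add: reflect_at_def)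
  qed
  ultimately show ?thesis by simp
qed

lemma reflect_frontier:
  assumes "b \<in> frontier \<Omega>"
  shows "reflect_at k 0 b \<in> frontier \<Omega>"
proof -
  have b: "b \<in> closure \<Omega>" "b \<notin> \<Omega>" using assms open_\<Omega> by (auto simp: frontier_def interior_open)
  have sym: "reflect_at k 0 x \<in> \<Omega>" if "x \<in> \<Omega>" for x
    using symmetric_\<Omega> that unfolding symmetric_in_def reflect_eq_reflect_at by blast
  have "continuous_on (closure \<Omega>) (reflect_at k 0)" by (intro continuous_intros)
  then have "reflect_at k 0 ` closure \<Omega> \<subseteq> closure \<Omega>"
    by (rule image_closure_subset) (use sym closure_subset in auto)
  then have "reflect_at k 0 b \<in> closure \<Omega>" using b by auto
  moreover have "reflect_at k 0 b \<notin> \<Omega>" using sym[of "reflect_at k 0 b"] b by auto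
  ultimately show ?thesis by (intro frontier_\<Omega>I[of _ \<Omega>]) auto
qed

lemma reflected_system:
  "moving_plane_system \<Omega> k m \<alpha> f L B (\<lambda>j x. u j (reflect_at k 0 x))
     (\<lambda>j i x. (if i = k then - 1 else 1) * u1 j i (reflect_at k 0 x)) (\<lambda>j i x. u2 j i (reflect_at k 0 x))"
proof unfold_locales
  fix j assume j: "j < m"
  show "twice_diff_on (\<Omega> - {0}) (\<lambda>x. u j (reflect_at k 0 x))
      (\<lambda>i x. (if i = k then - 1 else 1) * u1 j i (reflect_at k 0 x)) (\<lambda>i x. u2 j i (reflect_at k 0 x))"
    by (rule twice_diff_on_reflect_at[OF twice_diff_u[OF j] reflect_punctured])
  fix b assume b: "b \<in> frontier \<Omega>"
  show "((\<lambda>x. u j (reflect_at k 0 x)) \<longlongrightarrow> 0) (at b within \<Omega> - {0})"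
  proof (rule tendstoI)
    fix e :: real assume "0 < e"
    from eventually_abs_u_less[OF j reflect_frontier[OF b] this]
    have ev: "\<forall>\<^sub>F x in nhds (reflect_at k 0 b). x \<in> \<Omega> - {0} \<longrightarrow> \<bar>u j x\<bar> < e" .
    have "(reflect_at k 0 \<longlongrightarrow> reflect_at k 0 b) (at b within \<Omega> - {0})"
      unfolding reflect_at_def by (intro tendsto_intros)
    from eventually_compose_filterlim[OF ev this]
    show "\<forall>\<^sub>F x in at b within \<Omega> - {0}. dist (u j (reflect_at k 0 x)) 0 < e"
      unfolding eventually_at_filter by eventually_elim (use reflect_punctured in auto)
  qed
qed (use dim open_\<Omega> bounded_\<Omega> connected_\<Omega> convex_\<Omega> symmetric_\<Omega> m_pos \<alpha>_nonneg L_nonneg f_lipschitz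
      f_mono f_nonneg laplacian_u u0_pos u_below reflect_punctured in auto)

text \<open>
  The limit of the ordering gives one inequality; the same applied to the mirror image of the system
  gives the other one.
\<close>

lemma u0_symmetric:
  assumes "x \<in> \<Omega> - {0}"
  shows "u 0 (reflect k x) = u 0 x"
proof -
  interpret refl: moving_plane_system \<Omega> k m \<alpha> f L B "\<lambda>j x. u j (reflect_at k 0 x)"
     "\<lambda>j i x. (if i = k then - 1 else 1) * u1 j i (reflect_at k 0 x)" "\<lambda>j i x. u2 j i (reflect_at k 0 x)"
    by (rule reflected_system)
  have pos: "u 0 (reflect k x) = u 0 x" if "x \<in> \<Omega>" "0 < x $ k" for x
    using u0_le_reflect[OF that] refl.u0_le_reflect[OF that] by (simp add: reflect_eq_reflect_at)
  consider "0 < x $ k" | "x $ k = 0" | "x $ k < 0" by linarith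
  then show ?thesis
  proof cases
    case 1
    then show ?thesis using pos assms by simp
  next
    case 2
    then show ?thesis by (simp add: reflect_eq_reflect_at reflect_at_def)
  next
    case 3
    have "reflect_at k 0 x \<in> \<Omega>" "0 < reflect_at k 0 x $ k"
      using reflect_punctured[OF assms] 3 by (auto simp: reflect_at_nth)
    from pos[OF this] show ?thesis by (simp add: reflect_eq_reflect_at)
  qed
qed

text \<open>
  The plane halfway between \<open>x\<close> and \<open>y\<close> maps \<open>y\<close> to \<open>x\<close>.
\<close>

lemma u0_decreasing:
  assumes "y \<in> \<Omega>" "\<And>j. j \<noteq> k \<Longrightarrow> x $ j = y $ j" "0 < x $ k" "x $ k < y $ k"
  shows "u 0 y < u 0 x"
proof -
  define l where "l = (x $ k + y $ k) / 2"
  have l: "0 < l" "l < y $ k" using assms by (auto simp: l_def)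
  have "reflect_at k l y $ j = x $ j" for j
    using assms(2)[of j] by (auto simp: reflect_at_nth l_def field_simps)
  then have eq: "reflect_at k l y = x" by (simp add: vec_eq_iff)
  have "y \<noteq> reflect_at k l 0"
  proof
    assume "y = reflect_at k l 0"
    then have "x = 0" using eq by simp
    then show False using assms(3) by simp
  qed
  then have "y \<in> cap l" using assms(1) l by (simp add: cap_def)
  from u0_less_reflect_at[OF l(1) this] show ?thesis by (simp add: eq)
qed

end

section \<open>Linear combinations and the iterated Laplacian\<close>

lemma iter_partial_Cons: "iter_partial (i # is) f = partial_deriv i (iter_partial is f)"
  by (simp add: iter_partial_def)

lemma iter_partial_snoc: "iter_partial (is @ [i]) f = iter_partial is (partial_deriv i f)"
  by (simp add: iter_partial_def)

lemma Ck_on_le: "Ck_on k U f \<Longrightarrow> l \<le> k \<Longrightarrow> Ck_on l U f"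
  by (simp add: Ck_on_def)

lemma Ck_on_partial_deriv:
  assumes "Ck_on (Suc k) U f"
  shows "Ck_on k U (partial_deriv i f)"
  using assms unfolding Ck_on_def iter_partial_snoc[symmetric] by auto

lemma Ck_on_partial_DERIV:
  assumes "Ck_on k U f" "length is < k" "x \<in> U"
  shows "((\<lambda>t. iter_partial is f (x + t *\<^sub>R axis i 1)) has_real_derivative iter_partial (i # is) f x) (at 0)"
  using assms unfolding Ck_on_def iter_partial_Cons partial_deriv_def
  by (auto intro: field_differentiable_derivI)

lemma DERIV_partial_linear_combination:
  fixes U :: "(real ^ 'n::finite) set"
  assumes U: "open U" and f: "\<And>j. j \<in> A \<Longrightarrow> Ck_on k U (f j)"
    and len: "length is < k" and x: "x \<in> U"
    and eq: "\<And>x. x \<in> U \<Longrightarrow> iter_partial is g x = (\<Sum>j\<in>A. c j * iter_partial is (f j) x)"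
  shows "((\<lambda>t. iter_partial is g (x + t *\<^sub>R axis i 1)) has_real_derivative
      (\<Sum>j\<in>A. c j * iter_partial (i # is) (f j) x)) (at 0)"
  by (rule DERIV_axis_cong[OF U x eq])
    (auto intro!: DERIV_sum DERIV_cmult Ck_on_partial_DERIV[OF f len x])

text \<open>
  Additivity of \<open>deriv\<close> needs differentiability, so the induction carries the regularity along; the
  identity on all of the open set is needed before it can be differentiated.
\<close>

lemma iter_partial_linear_combination:
  fixes U :: "(real ^ 'n::finite) set"
  assumes U: "open U" and f: "\<And>j. j \<in> A \<Longrightarrow> Ck_on k U (f j)"
    and g: "\<And>x. x \<in> U \<Longrightarrow> g x = (\<Sum>j\<in>A. c j * f j x)"
    and len: "length is \<le> k" and x: "x \<in> U"
  shows "iter_partial is g x = (\<Sum>j\<in>A. c j * iter_partial is (f j) x)"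
  using len x
proof (induction "is" arbitrary: x)
  case Nil
  then show ?case by (simp add: iter_partial_def g)
next
  case (Cons i "is")
  then have len: "length is < k" by simp
  have "((\<lambda>t. iter_partial is g (x + t *\<^sub>R axis i 1)) has_real_derivative
      (\<Sum>j\<in>A. c j * iter_partial (i # is) (f j) x)) (at 0)"
    by (rule DERIV_partial_linear_combination[OF U f len Cons.prems(2)]) (use Cons len in auto)
  then show ?case unfolding iter_partial_Cons[of i "is" g] partial_deriv_def by (rule DERIV_imp_deriv)
qed

lemma Ck_on_linear_combination:
  fixes U :: "(real ^ 'n::finite) set"
  assumes U: "open U" and f: "\<And>j. j \<in> A \<Longrightarrow> Ck_on k U (f j)"
    and g: "\<And>x. x \<in> U \<Longrightarrow> g x = (\<Sum>j\<in>A. c j * f j x)"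
  shows "Ck_on k U g"
  unfolding Ck_on_def
proof (intro conjI allI impI ballI)
  note eq = iter_partial_linear_combination[OF U f g]
  fix "is" :: "'n list"
  show "(\<lambda>t. iter_partial is g (x + t *\<^sub>R axis i 1)) field_differentiable at 0"
    if "length is < k" "x \<in> U" for i x
    using DERIV_partial_linear_combination[OF U f that eq] that unfolding field_differentiable_def by fastforce
  assume len: "length is \<le> k"
  have "continuous_on U (\<lambda>x. \<Sum>j\<in>A. c j * iter_partial is (f j) x)"
    using f len unfolding Ck_on_def by (intro continuous_intros) auto
  then show "continuous_on U (iter_partial is g)"
    by (rule continuous_on_eq) (simp add: eq len)
qed

lemma neg_laplacian_eq_iter_partial: "neg_laplacian f x = (\<Sum>i\<in>UNIV. (- 1) * iter_partial [i, i] f x)"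
  by (simp add: neg_laplacian_def iter_partial_def sum_negf)

lemma Ck_on_neg_laplacian:
  fixes U :: "(real ^ 'n::finite) set"
  assumes "open U" "Ck_on (Suc (Suc k)) U f"
  shows "Ck_on k U (neg_laplacian f)"
  by (rule Ck_on_linear_combination[OF assms(1), where A = UNIV and c = "\<lambda>_. - 1"
        and f = "\<lambda>i. partial_deriv i (partial_deriv i f)"])
    (auto intro!: Ck_on_partial_deriv assms(2) simp: neg_laplacian_def sum_negf)

lemma Ck_on_neg_laplacian_power:
  fixes U :: "(real ^ 'n::finite) set"
  assumes "open U" "Ck_on (2 * m) U f" "j \<le> m"
  shows "Ck_on (2 * (m - j)) U ((neg_laplacian ^^ j) f)"
  using assms(3)
proof (induction j)
  case 0
  then show ?case using assms(2) by simp
next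
  case (Suc j)
  then have "Ck_on (2 * (m - j)) U ((neg_laplacian ^^ j) f)" by simp
  moreover have "2 * (m - j) = Suc (Suc (2 * (m - Suc j)))" using Suc.prems by simp
  ultimately show ?case using Ck_on_neg_laplacian[OF assms(1)] by simp
qed

lemma neg_laplacian_linear_combination:
  fixes U :: "(real ^ 'n::finite) set"
  assumes U: "open U" and f: "\<And>j. j \<in> A \<Longrightarrow> Ck_on 2 U (f j)" and x: "x \<in> U"
  shows "neg_laplacian (\<lambda>x. \<Sum>j\<in>A. c j * f j x) x = (\<Sum>j\<in>A. c j * neg_laplacian (f j) x)"
proof -
  have "iter_partial [i, i] (\<lambda>x. \<Sum>j\<in>A. c j * f j x) x = (\<Sum>j\<in>A. c j * iter_partial [i, i] (f j) x)" for i
    by (rule iter_partial_linear_combination[OF U f _ _ x]) auto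
  then have "neg_laplacian (\<lambda>x. \<Sum>j\<in>A. c j * f j x) x =
      (\<Sum>i\<in>UNIV. \<Sum>j\<in>A. c j * ((- 1) * iter_partial [i, i] (f j) x))"
    by (simp add: neg_laplacian_eq_iter_partial sum_distrib_left sum_negf)
  also have "\<dots> = (\<Sum>j\<in>A. c j * neg_laplacian (f j) x)"
    unfolding neg_laplacian_eq_iter_partial sum_distrib_left by (rule sum.swap)
  finally show ?thesis .
qed

lemma twice_diff_on_Ck_on:
  fixes U :: "(real ^ 'n::finite) set"
  assumes "Ck_on 2 U v"
  shows "twice_diff_on U v (\<lambda>i. partial_deriv i v) (\<lambda>i. partial_deriv i (partial_deriv i v))"
  unfolding twice_diff_on_def
proof (intro conjI allI ballI)
  have cont: "continuous_on U (iter_partial is v)" if "length is \<le> 2" for "is"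
    using assms that by (simp add: Ck_on_def)
  show "continuous_on U v" using cont[of "[]"] by (simp add: iter_partial_def)
  fix i
  show "continuous_on U (partial_deriv i v)" using cont[of "[i]"] by (simp add: iter_partial_def)
  show "continuous_on U (partial_deriv i (partial_deriv i v))" using cont[of "[i, i]"] by (simp add: iter_partial_def)
  fix x assume x: "x \<in> U"
  show "((\<lambda>t. v (x + t *\<^sub>R axis i 1)) has_real_derivative partial_deriv i v x) (at 0)"
    using Ck_on_partial_DERIV[OF assms, of "[]" x i] x by (simp add: iter_partial_def)
  show "((\<lambda>t. partial_deriv i v (x + t *\<^sub>R axis i 1)) has_real_derivative partial_deriv i (partial_deriv i v) x) (at 0)"
    using Ck_on_partial_DERIV[OF assms, of "[i]" x i] x by (simp add: iter_partial_def)
qed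

section \<open>The factors of the operator\<close>

text \<open>
  The symbol, in \<open>t = - \<Delta>\<close>, of the product of the first \<open>j\<close> factors of the operator.
\<close>

definition operator_poly :: "(nat \<Rightarrow> real) \<Rightarrow> nat \<Rightarrow> real poly" where
  "operator_poly \<alpha> j = (\<Prod>i=1..j. [:\<alpha> i, 1:])"

lemma coeff_operator_poly_Suc:
  "coeff (operator_poly \<alpha> (Suc j)) k = \<alpha> (Suc j) * coeff (operator_poly \<alpha> j) k + coeff (pCons 0 (operator_poly \<alpha> j)) k"
  by (simp add: operator_poly_def prod.nat_ivl_Suc' mult.commute)

lemma coeff_operator_poly_beyond: "j < k \<Longrightarrow> coeff (operator_poly \<alpha> j) k = 0"
proof (induction j arbitrary: k)
  case (Suc j)
  then show ?case unfolding coeff_operator_poly_Suc by (cases k) auto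
qed (simp add: operator_poly_def)

lemma coeff_operator_poly_top: "coeff (operator_poly \<alpha> j) j = 1"
proof (induction j)
  case (Suc j)
  then show ?case unfolding coeff_operator_poly_Suc by (simp add: coeff_operator_poly_beyond)
qed (simp add: operator_poly_def)

lemma coeff_operator_poly_nonneg:
  assumes "\<And>i. i \<in> {1..j} \<Longrightarrow> 0 \<le> \<alpha> i"
  shows "0 \<le> coeff (operator_poly \<alpha> j) k"
  using assms
proof (induction j arbitrary: k)
  case 0
  then show ?case by (cases k) (auto simp: operator_poly_def)
next
  case (Suc j)
  have "0 \<le> coeff (pCons 0 (operator_poly \<alpha> j)) k" using Suc by (cases k) auto
  then show ?case unfolding coeff_operator_poly_Suc using Suc by simp
qed

text \<open>
  A monic polynomial of degree \<open>m\<close> with nonnegative coefficients is at least \<open>t\<^sup>m > 0\<close> at \<open>t > 0\<close>, so it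
  has no positive root \<open>- \<alpha>\<^sub>i\<close>.
\<close>

lemma roots_nonneg_of_s_coeff_nonneg:
  assumes s: "\<forall>k<m. 0 \<le> s_coeff m \<alpha> k" and i: "i \<in> {1..m}"
  shows "0 \<le> \<alpha> i"
proof (rule ccontr)
  assume "\<not> 0 \<le> \<alpha> i"
  then have t: "0 < - \<alpha> i" by simp
  let ?p = "operator_poly \<alpha> m"
  have "degree ?p \<le> m" by (rule degree_le) (auto simp: coeff_operator_poly_beyond)
  moreover have "m \<le> degree ?p" by (rule le_degree) (simp add: coeff_operator_poly_top)
  ultimately have deg: "degree ?p = m" by simp
  have nn: "0 \<le> coeff ?p k" if "k \<le> m" for k
    using s that coeff_operator_poly_top[of \<alpha> m] by (cases "k = m") (auto simp: s_coeff_def operator_poly_def)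
  have "(- \<alpha> i) ^ m \<le> (\<Sum>k\<le>m. coeff ?p k * (- \<alpha> i) ^ k)"
    using member_le_sum[of m "{..m}" "\<lambda>k. coeff ?p k * (- \<alpha> i) ^ k"] nn t
    by (simp add: coeff_operator_poly_top)
  also have "\<dots> = poly ?p (- \<alpha> i)" by (simp add: poly_altdef deg)
  also have "\<dots> = 0" using i by (auto simp: operator_poly_def poly_prod)
  finally show False using zero_less_power[OF t, of m] by linarith
qed

section \<open>Symmetry and monotonicity\<close>

theorem theorem1p2:
  fixes \<Omega> :: "(real ^ 'n::finite) set" and i\<^sub>1 :: 'n
    and m :: nat and \<alpha> :: "nat \<Rightarrow> real"
    and f :: "real \<Rightarrow> real" and u :: "real ^ 'n \<Rightarrow> real"
  assumes "CARD('n) \<ge> 2" and "m \<ge> 1"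
    and "\<forall>k<m. s_coeff m \<alpha> k \<ge> 0"
    and "open \<Omega>" and "bounded \<Omega>" and "connected \<Omega>" and "0 \<in> \<Omega>"
    and "convex_in_direction i\<^sub>1 \<Omega>" and "symmetric_in i\<^sub>1 \<Omega>"
    and "\<exists>L. L-lipschitz_on {0..} f" and "mono_on {0..} f" and "f 0 \<ge> 0"
    and "Ck_on (2 * m) (\<Omega> - {0}) u"
    and "Ck_up_to (2 * m - 2) (\<Omega> - {0}) (closure \<Omega> - {0}) u"
    and "\<forall>x\<in>\<Omega> - {0}. (\<Sum>k=0..m. s_coeff m \<alpha> k * (neg_laplacian ^^ k) u x) = f (u x)"
    and "\<forall>x\<in>\<Omega> - {0}. u x > 0"
    and "\<forall>j<m. vanishes_on_boundary (\<Omega> - {0}) (frontier \<Omega>) ((neg_laplacian ^^ j) u)"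
    and "\<forall>j\<in>{1..<m}. bdd_below ((neg_laplacian ^^ j) u ` (\<Omega> - {0}))"
  shows "(\<forall>x\<in>\<Omega> - {0}. u x = u (reflect i\<^sub>1 x)) \<and>
         (\<forall>x\<in>\<Omega>. \<forall>y\<in>\<Omega>. (\<forall>j. j \<noteq> i\<^sub>1 \<longrightarrow> x $ j = y $ j) \<longrightarrow>
            0 < x $ i\<^sub>1 \<longrightarrow> x $ i\<^sub>1 < y $ i\<^sub>1 \<longrightarrow> u y < u x)"
proof -
  let ?V = "\<Omega> - {0}"
  have V: "open ?V" using \<open>open \<Omega>\<close> by auto
  define N where "N k = (neg_laplacian ^^ k) u" for k
  \<comment> \<open>The sum stops before \<open>m\<close>: only these iterates are twice differentiable, and the degree is at most \<open>m - 1\<close> for \<open>j < m\<close>.\<close>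
  define U where "U j x = (\<Sum>k<m. coeff (operator_poly \<alpha> j) k * N k x)" for j x
  obtain L where L: "L-lipschitz_on {0..} f" using assms by blast
  have \<alpha>: "0 \<le> \<alpha> i" if "i \<in> {1..m}" for i
    by (rule roots_nonneg_of_s_coeff_nonneg[OF assms(3) that])
  have coeff_nonneg: "0 \<le> coeff (operator_poly \<alpha> j) k" if "j \<le> m" for j k
    by (rule coeff_operator_poly_nonneg) (use \<alpha> that in auto)
  have N2: "Ck_on 2 ?V (N k)" if "k < m" for k
    unfolding N_def by (rule Ck_on_le[OF Ck_on_neg_laplacian_power[OF V assms(13)]]) (use that in auto)
  have U2: "Ck_on 2 ?V (U j)" for j
    by (rule Ck_on_linear_combination[OF V, where A = "{..<m}" and f = N]) (auto simp: N2 U_def)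
  have U0: "U 0 = u"
  proof
    fix x
    have "U 0 x = (\<Sum>k<m. if k = 0 then N k x else 0)"
      unfolding U_def operator_poly_def by (intro sum.cong) (auto simp: coeff_1)
    then show "U 0 x = u x" using assms(2) by (simp add: N_def)
  qed
  have step: "neg_laplacian (U j) x + \<alpha> (Suc j) * U j x = (if Suc j < m then U (Suc j) x else f (U 0 x))"
    if j: "j < m" and x: "x \<in> ?V" for j x
  proof -
    let ?p = "operator_poly \<alpha> j" and ?q = "operator_poly \<alpha> (Suc j)"
    have "neg_laplacian (U j) x = (\<Sum>k<m. coeff ?p k * neg_laplacian (N k) x)"
      unfolding U_def[abs_def] by (rule neg_laplacian_linear_combination[OF V _ x]) (use N2 in auto)
    also have "\<dots> = (\<Sum>k<m. coeff (pCons 0 ?p) (Suc k) * N (Suc k) x)" by (simp add: N_def)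
    also have "\<dots> = (\<Sum>k<Suc m. coeff (pCons 0 ?p) k * N k x)" by (subst sum.lessThan_Suc_shift) simp
    finally have 1: "neg_laplacian (U j) x = (\<Sum>k<Suc m. coeff (pCons 0 ?p) k * N k x)" .
    have "U j x = (\<Sum>k<Suc m. coeff ?p k * N k x)"
      using j by (simp add: U_def coeff_operator_poly_beyond)
    then have "\<alpha> (Suc j) * U j x = (\<Sum>k<Suc m. \<alpha> (Suc j) * coeff ?p k * N k x)"
      by (simp only: sum_distrib_left mult.assoc)
    with 1 have sum: "neg_laplacian (U j) x + \<alpha> (Suc j) * U j x = (\<Sum>k<Suc m. coeff ?q k * N k x)"
      unfolding coeff_operator_poly_Suc by (simp only: sum.distrib[symmetric] distrib_right add.commute)
    show ?thesis
    proof (cases "Suc j < m")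
      case True
      then show ?thesis unfolding sum by (simp add: U_def coeff_operator_poly_beyond)
    next
      case False
      then have "Suc j = m" using j by simp
      then have "(\<Sum>k<Suc m. coeff ?q k * N k x) = (\<Sum>k=0..m. s_coeff m \<alpha> k * (neg_laplacian ^^ k) u x)"
        by (simp only: s_coeff_def operator_poly_def N_def lessThan_Suc_atMost atMost_atLeast0)
      then show ?thesis unfolding sum using False assms(15) x by (simp add: U0)
    qed
  qed
  have "\<exists>b. \<forall>x\<in>?V. - b \<le> N k x" if "k < m" for k
  proof (cases "k = 0")
    case True
    then show ?thesis using assms(16) by (intro exI[of _ 0]) (auto simp: N_def less_imp_le)
  next
    case False
    then have "bdd_below (N k ` ?V)" using assms(18) that by (simp add: N_def)
    then obtain b where "\<And>x. x \<in> ?V \<Longrightarrow> b \<le> N k x" unfolding bdd_below_def by blast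
    then show ?thesis by (intro exI[of _ "- b"]) auto
  qed
  then obtain b where b: "\<And>k x. k < m \<Longrightarrow> x \<in> ?V \<Longrightarrow> - b k \<le> N k x" by metis
  define B where "B = (\<Sum>j<m. \<Sum>k<m. coeff (operator_poly \<alpha> j) k * \<bar>b k\<bar>)"
  have below: "- B \<le> U j x" if j: "j < m" and x: "x \<in> ?V" for j x
  proof -
    have "(\<Sum>k<m. coeff (operator_poly \<alpha> j) k * \<bar>b k\<bar>) \<le> B"
      unfolding B_def using j coeff_nonneg
      by (intro member_le_sum[of j "{..<m}" "\<lambda>j. \<Sum>k<m. coeff (operator_poly \<alpha> j) k * \<bar>b k\<bar>"] sum_nonneg mult_nonneg_nonneg) auto
    moreover have "(\<Sum>k<m. - (coeff (operator_poly \<alpha> j) k * \<bar>b k\<bar>)) \<le> U j x"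
      unfolding U_def
    proof (rule sum_mono)
      fix k assume "k \<in> {..<m}"
      then have "- \<bar>b k\<bar> \<le> N k x" using b[of k x] x by auto
      then have "coeff (operator_poly \<alpha> j) k * - \<bar>b k\<bar> \<le> coeff (operator_poly \<alpha> j) k * N k x"
        using j coeff_nonneg by (intro mult_left_mono) auto
      then show "- (coeff (operator_poly \<alpha> j) k * \<bar>b k\<bar>) \<le> coeff (operator_poly \<alpha> j) k * N k x" by simp
    qed
    ultimately show ?thesis by (simp add: sum_negf)
  qed
  interpret moving_plane_system \<Omega> i\<^sub>1 m "\<lambda>j. \<alpha> (Suc j)" f L B U "\<lambda>j i. partial_deriv i (U j)"
    "\<lambda>j i. partial_deriv i (partial_deriv i (U j))"
  proof unfold_locales
    show "0 \<le> L" using L by (rule lipschitz_on_nonneg)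
    show "f t - f s \<le> L * (t - s)" if "0 \<le> s" "s \<le> t" for s t
      using lipschitz_onD[OF L, of t s] that by (simp add: dist_real_def)
    show "f s \<le> f t" if "0 \<le> s" "s \<le> t" for s t
      by (rule mono_onD[OF assms(11)]) (use that in auto)
    show "twice_diff_on ?V (U j) (\<lambda>i. partial_deriv i (U j)) (\<lambda>i. partial_deriv i (partial_deriv i (U j)))" for j
      by (rule twice_diff_on_Ck_on[OF U2])
    show "(\<Sum>i\<in>UNIV. partial_deriv i (partial_deriv i (U j)) x) =
        \<alpha> (Suc j) * U j x - (if Suc j < m then U (Suc j) x else f (U 0 x))" if "j < m" "x \<in> ?V" for j x
      using step[OF that] by (simp add: neg_laplacian_def)
    show "(U j \<longlongrightarrow> 0) (at b within ?V)" if "j < m" "b \<in> frontier \<Omega>" for j b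
    proof -
      have "(N k \<longlongrightarrow> 0) (at b within ?V)" if "k < m" for k
        using assms(17) that \<open>b \<in> frontier \<Omega>\<close> by (simp add: vanishes_on_boundary_def N_def)
      then have "(U j \<longlongrightarrow> (\<Sum>k<m. coeff (operator_poly \<alpha> j) k * 0)) (at b within ?V)"
        unfolding U_def[abs_def] by (intro tendsto_sum tendsto_mult tendsto_const) auto
      then show ?thesis by simp
    qed
  qed (use assms \<alpha> below in \<open>auto simp: U0\<close>)
  show ?thesis
    using u0_symmetric u0_decreasing unfolding U0 by (metis (no_types, lifting))
qed

end
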